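(* Let $A$ be a commutative unital $\mathbb{R}$-algebra, let $\rho$ be a submultiplicative seminorm on $A$, let $d\ge1$ be an integer, and let $S$ be a $\sum A^{2d}$-module of $A$. If $L:A\to\mathbb{R}$ is a $\rho$-continuous linear functional such that $L(s)\ge 0$ for all $s\in S$, then there exists a unique Radon measure $\mu$ on $\mathcal{X}(A)$ such that $$L(a)=\int \hat a\,d\mu\quad\text{for all }a\in A.$$ Moreover, $\mathrm{supp}(\mu)\subseteq\mathcal{K}_S\cap\mathfrak{sp}(\rho)$.
   Context: A seminorm on $A$ is a map $\rho:A\to[0,\infty)$ with $\rho(rx)=|r|\rho(x)$ and $\rho(x+y)\le\rho(x)+\rho(y)$ for $r\in\mathbb{R}$, $x,y\in A$; it is submultiplicative if also $\rho(xy)\le\rho(x)\rho(y)$ for all $x,y\in A$. $\mathcal{X}(A)$ denotes the set of all unital $\mathbb{R}$-algebra homomorphisms $A\to\mathbb{R}$, with the topology induced from the product topology on $\mathbb{R}^A$ (equivalently, the weakest topology making all $\hat a$ continuous, where $\hat a:\mathcal{X}(A)\to\mathbb{R}$, $\hat a(\alpha)=\alpha(a)$, for $a\in A$). $\mathfrak{sp}(\rho)$ denotes the set of all $\rho$-continuous $\alpha\in\mathcal{X}(A)$. A $\sum A^{2d}$-module of $A$ is a subset $S\subseteq A$ with $1\in S$, $S+S\subseteq S$ and $a^{2d}\cdot S\subseteq S$ for every $a\in A$. $\mathcal{K}_S:=\{\alpha\in\mathcal{X}(A):\hat a(\alpha)\ge0\text{ for all }a\in S\}$. A Radon measure on a Hausdorff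 space is a (positive) measure on its Borel $\sigma$-algebra that is locally finite (every point has a neighbourhood of finite measure) and inner regular (the measure of each Borel set is the supremum of the measures of its compact subsets). Writing $L(a)=\int\hat a\,d\mu$ includes that $\hat a$ is $\mu$-integrable. *)

theory Defs
  imports "HOL-Analysis.Analysis"
begin

(* Commutative unital real algebras are given by the sort {real_algebra, comm_ring, comm_monoid_mult}.
   Unlike {real_algebra_1, comm_ring_1}, it does not impose 0 ~= 1, so the zero algebra is included. *)

definition seminorm :: "('a::real_vector \<Rightarrow> real) \<Rightarrow> bool" where
  "seminorm \<rho> \<longleftrightarrow> (\<forall>x. 0 \<le> \<rho> x) \<and> (\<forall>r x. \<rho> (r *\<^sub>R x) = \<bar>r\<bar> * \<rho> x) \<and>
     (\<forall>x y. \<rho> (x + y) \<le> \<rho> x + \<rho> y)"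

definition submultiplicative_seminorm :: "('a::real_algebra \<Rightarrow> real) \<Rightarrow> bool" where
  "submultiplicative_seminorm \<rho> \<longleftrightarrow> seminorm \<rho> \<and> (\<forall>x y. \<rho> (x * y) \<le> \<rho> x * \<rho> y)"

definition seminorm_topology :: "('a::real_vector \<Rightarrow> real) \<Rightarrow> 'a topology" where
  "seminorm_topology \<rho> = topology_generated_by {{y. \<rho> (y - x) < e} | x e. 0 < e}"

definition seminorm_continuous :: "('a::real_vector \<Rightarrow> real) \<Rightarrow> ('a \<Rightarrow> real) \<Rightarrow> bool" where
  "seminorm_continuous \<rho> f \<longleftrightarrow> continuous_map (seminorm_topology \<rho>) euclideanreal f"

definition characters :: "('a::{real_algebra, comm_ring, comm_monoid_mult} \<Rightarrow> real) set" where
  "characters = {\<alpha>. linear \<alpha> \<and> (\<forall>x y. \<alpha> (x * y) = \<alpha> x * \<alpha> y) \<and> \<alpha> 1 = 1}"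

(* The Euclidean (type class) topology on a function type is the product topology. *)
definition character_topology ::
  "('a::{real_algebra, comm_ring, comm_monoid_mult} \<Rightarrow> real) topology" where
  "character_topology = top_of_set characters"

definition gelfand_spectrum ::
  "('a::{real_algebra, comm_ring, comm_monoid_mult} \<Rightarrow> real) \<Rightarrow> ('a \<Rightarrow> real) set" where
  "gelfand_spectrum \<rho> = {\<alpha> \<in> characters. seminorm_continuous \<rho> \<alpha>}"

(* For n = 2d these are the modules over the sums of 2d-th powers. *)
definition power_module :: "nat \<Rightarrow> 'a::{real_algebra, comm_ring, comm_monoid_mult} set \<Rightarrow> bool" where
  "power_module n S \<longleftrightarrow>
     1 \<in> S \<and> (\<forall>x\<in>S. \<forall>y\<in>S. x + y \<in> S) \<and> (\<forall>a. \<forall>x\<in>S. a ^ n * x \<in> S)"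

definition nonneg_characters ::
  "'a::{real_algebra, comm_ring, comm_monoid_mult} set \<Rightarrow> ('a \<Rightarrow> real) set" where
  "nonneg_characters S = {\<alpha> \<in> characters. \<forall>a\<in>S. 0 \<le> \<alpha> a}"

definition borel_sigma :: "'b topology \<Rightarrow> 'b measure" where
  "borel_sigma T = sigma (topspace T) {U. openin T U}"

(* The Hausdorff condition ensures that compact sets are Borel, so that emeasure M K is meaningful. *)
definition radon_measure :: "'b topology \<Rightarrow> 'b measure \<Rightarrow> bool" where
  "radon_measure T M \<longleftrightarrow>
     Hausdorff_space T \<and> sets M = sets (borel_sigma T) \<and>
     (\<forall>x\<in>topspace T. \<exists>U. openin T U \<and> x \<in> U \<and> emeasure M U < \<infinity>) \<and>
     (\<forall>B\<in>sets M. emeasure M B = (SUP K\<in>{K. compactin T K \<and> K \<subseteq> B}. emeasure M K))"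

definition measure_support :: "'b topology \<Rightarrow> 'b measure \<Rightarrow> 'b set" where
  "measure_support T M = {x \<in> topspace T. \<forall>U. openin T U \<and> x \<in> U \<longrightarrow> 0 < emeasure M U}"

definition represents ::
  "('a \<Rightarrow> real) measure \<Rightarrow> ('a::{real_algebra, comm_ring, comm_monoid_mult} \<Rightarrow> real) \<Rightarrow> bool" where
  "represents M L \<longleftrightarrow> (\<forall>a. integrable M (\<lambda>\<alpha>. \<alpha> a) \<and> L a = (\<integral>\<alpha>. \<alpha> a \<partial>M))"

end

theory Submission
  imports Defs
begin

text \<open>
  Why the theorem holds. Put \<open>n = 2 * d\<close> and let \<open>K\<close> be the set of the \<open>\<rho>\<close>-continuous
  characters that are nonnegative on \<open>S\<close>. A \<open>\<rho>\<close>-continuous character satisfies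
  \<open>\<bar>\<alpha> a\<bar> \<le> \<rho> a\<close>, so \<open>K\<close> is a closed subset of a product of compact intervals and hence compact.

  Positivity on \<open>K\<close>. The decisive fact is that \<open>L a \<ge> 0\<close> whenever \<open>a\<close> is nonnegative on \<open>K\<close>.
  For small \<open>\<rho> x\<close>, the element \<open>1 - x\<close> is a \<open>\<rho>\<close>-limit of \<open>n\<close>-th powers, found by iterating a
  contraction (\<open>near_one_limit_of_powers\<close>). Hence every \<open>\<rho>\<close>-bounded functional \<open>\<phi>\<close> that is
  nonnegative on \<open>S\<close> is nonnegative at \<open>(1 - x) * s\<close> for \<open>s \<in> S\<close>, which yields a bound
  \<open>\<bar>\<phi> (x * s)\<bar> \<le> c * \<rho> x * \<phi> s\<close> with a constant \<open>c\<close> that is the same for all \<open>\<phi>\<close>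
  (\<open>positive_functional_bound\<close>). In particular \<open>L = 0\<close> if \<open>L 1 = 0\<close>, and otherwise \<open>L\<close> can be
  normalized to the value \<open>1\<close> at \<open>1\<close>. By the bound, the normalized functionals of this kind form a compact set, and
  the coordinate \<open>a\<close> attains its minimum over this set at an extreme point. If \<open>\<phi>\<close> is such a point
  and \<open>u\<close> is small, then \<open>\<phi>\<close> is a proper convex combination of the normalizations of
  \<open>y \<mapsto> \<phi> ((1 + u) * y)\<close> and \<open>y \<mapsto> \<phi> ((1 - u) * y)\<close>, which belong to the same set; extremality makes \<open>\<phi>\<close>
  multiplicative, so \<open>\<phi> \<in> K\<close>, and the minimum is nonnegative (\<open>nonneg_on_spectrum_imp_nonneg\<close>).

  Existence. A functional that is positive on the compact set \<open>K\<close> is integration against a Radon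
  measure carried by \<open>K\<close>. The construction of Riesz and Markov can be run on the algebra itself:
  the content of a compact set \<open>C\<close> is the infimum of \<open>L b\<close> over the \<open>b \<ge> 0\<close> that are at least \<open>1\<close> on
  \<open>C\<close>, and the Stone-Weierstrass theorem supplies elements of the algebra that separate disjoint
  compact sets (\<open>separating_element\<close>).

  Uniqueness. For any representing Radon measure, Markov's inequality applied to the even powers
  of \<open>a\<close> shows that \<open>\<bar>\<alpha> a\<bar> \<le> \<rho> a\<close> almost everywhere, and inner regularity turns these conditions,
  possibly uncountably many, into concentration on the compact set of \<open>\<rho>\<close>-continuous characters
  (\<open>representing_measure_concentrated\<close>). On a compact set, the elements of the algebra approximate
  indicators well enough to determine the measure of every compact subset. So the measure
  constructed above is the only one, and its support lies in the closed set \<open>K\<close>.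
\<close>

section \<open>Seminorms and continuity\<close>

lemma seminormD:
  assumes "seminorm \<rho>"
  shows "0 \<le> \<rho> x" "\<rho> (r *\<^sub>R x) = \<bar>r\<bar> * \<rho> x" "\<rho> (x + y) \<le> \<rho> x + \<rho> y"
    "\<rho> 0 = 0" "\<rho> (- x) = \<rho> x" "\<rho> (x - y) \<le> \<rho> x + \<rho> y"
proof -
  show 1: "0 \<le> \<rho> x" and 2: "\<And>r x. \<rho> (r *\<^sub>R x) = \<bar>r\<bar> * \<rho> x"
    and 3: "\<And>x y. \<rho> (x + y) \<le> \<rho> x + \<rho> y"
    using assms by (auto simp: seminorm_def)
  show "\<rho> 0 = 0" using 2[of 0 0] by simp
  show 5: "\<rho> (- x) = \<rho> x" for x using 2[of "-1" x] by simp
  show "\<rho> (x - y) \<le> \<rho> x + \<rho> y" using 3[of x "- y"] 5[of y] by simp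
qed

text \<open>The seminorm balls form a base of the topology, so continuity at \<open>0\<close> bounds \<open>f\<close> by \<open>1\<close> on a
  ball around \<open>0\<close>, and scaling spreads this bound to all points.\<close>

lemma seminorm_continuous_iff_bounded:
  assumes \<rho>: "seminorm \<rho>" and f: "linear f"
  shows "seminorm_continuous \<rho> f \<longleftrightarrow> (\<exists>c. \<forall>x. \<bar>f x\<bar> \<le> c * \<rho> x)"
proof
  define B where "B = {{y. \<rho> (y - x) < e} | x e. 0 < e}"
  assume "seminorm_continuous \<rho> f"
  then have "openin (topology_generated_by B) {x \<in> topspace (topology_generated_by B). f x \<in> {-1<..<1}}"
    unfolding seminorm_continuous_def seminorm_topology_def B_def[symmetric]
    by (rule openin_continuous_map_preimage) simp
  moreover have "topspace (topology_generated_by B) = UNIV"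
  proof -
    have "x \<in> \<Union>B" for x
    proof (rule UnionI)
      show "{y. \<rho> (y - x) < 1} \<in> B" unfolding B_def by (rule CollectI) (blast intro: zero_less_one)
      show "x \<in> {y. \<rho> (y - x) < 1}" using seminormD(4)[OF \<rho>] by simp
    qed
    then show ?thesis by auto
  qed
  ultimately have op: "generate_topology_on B {x. f x \<in> {-1<..<1}}"
    by (simp del: topology_generated_by_topspace add: openin_topology_generated_by_iff)
  have nb: "\<exists>e>0. {y. \<rho> (y - x) < e} \<subseteq> U" if "generate_topology_on B U" "x \<in> U" for x U
    using that
  proof (induction arbitrary: x rule: generate_topology_on.induct)
    case Empty then show ?case by simp
  next
    case (Int a b)
    then obtain e e' where "e > 0" "{y. \<rho> (y - x) < e} \<subseteq> a" "e' > 0" "{y. \<rho> (y - x) < e'} \<subseteq> b"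
      by blast
    then show ?case by (intro exI[of _ "min e e'"]) auto
  next
    case (UN K) then show ?case by blast
  next
    case (Basis s)
    then obtain z e where s: "s = {y. \<rho> (y - z) < e}" by (auto simp: B_def)
    have "\<rho> (y - z) < e" if "\<rho> (y - x) < e - \<rho> (x - z)" for y
      using seminormD(3)[OF \<rho>, of "y - x" "x - z"] that by simp
    with Basis s show ?case by (intro exI[of _ "e - \<rho> (x - z)"]) auto
  qed
  have "f 0 = 0" using f by (rule linear_0)
  then obtain e where e0: "e > 0" and sub: "{y. \<rho> (y - 0) < e} \<subseteq> {x. f x \<in> {-1<..<1}}"
    using nb[OF op, of 0] by auto
  have e: "e > 0" "\<And>y. \<rho> y < e \<Longrightarrow> \<bar>f y\<bar> < 1"
    using e0 subsetD[OF sub] by (auto simp: abs_less_iff minus_less_iff)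
  have "\<bar>f x\<bar> \<le> (1 / e) * \<rho> x" for x
  proof -
    \<comment> \<open>Since \<open>\<rho> x\<close> may be \<open>0\<close>, the scaling uses numbers above it.\<close>
    have "\<bar>f x\<bar> * e \<le> t" if t: "t > \<rho> x" for t
    proof -
      have t0: "t > 0" using t seminormD(1)[OF \<rho>, of x] by linarith
      have "\<rho> ((e / t) *\<^sub>R x) < e"
        using t t0 e by (simp add: seminormD(2)[OF \<rho>] field_simps)
      then have "\<bar>(e / t) * f x\<bar> < 1" using e(2) by (metis linear_scale[OF f] real_scaleR_def)
      then have "(e / t) * \<bar>f x\<bar> < 1" using t0 e(1) by (simp add: abs_mult)
      then show ?thesis using t0 e(1) by (simp add: field_simps)
    qed
    then have "\<bar>f x\<bar> * e \<le> \<rho> x" by (rule dense_ge)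
    then show ?thesis using e by (simp add: field_simps)
  qed
  then show "\<exists>c. \<forall>x. \<bar>f x\<bar> \<le> c * \<rho> x" by blast
next
  assume "\<exists>c. \<forall>x. \<bar>f x\<bar> \<le> c * \<rho> x"
  then obtain c where c: "\<And>x. \<bar>f x\<bar> \<le> c * \<rho> x" by blast
  define d where "d = max c 1"
  have d: "\<bar>f x\<bar> \<le> d * \<rho> x" "d > 0" for x
    using c[of x] mult_right_mono[of c d "\<rho> x"] seminormD(1)[OF \<rho>, of x] by (auto simp: d_def)
  show "seminorm_continuous \<rho> f"
    unfolding seminorm_continuous_def continuous_map_def
  proof (intro conjI allI impI)
    fix V assume "openin euclideanreal V"
    then have V: "open V" by simp
    let ?T = "seminorm_topology \<rho>"
    have "\<exists>W. openin ?T W \<and> x \<in> W \<and> W \<subseteq> {x \<in> topspace ?T. f x \<in> V}"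
      if "x \<in> topspace ?T" "f x \<in> V" for x
    proof -
      obtain e where e: "e > 0" "\<And>r. \<bar>r - f x\<bar> < e \<Longrightarrow> r \<in> V"
        using V \<open>f x \<in> V\<close> by (auto simp: open_dist dist_real_def)
      define W where "W = {y. \<rho> (y - x) < e / d}"
      have "openin ?T W" unfolding seminorm_topology_def W_def
        by (rule topology_generated_by_Basis, rule CollectI) (use e(1) d(2) in \<open>blast intro: divide_pos_pos\<close>)
      moreover have "x \<in> W" using e d(2) seminormD(4)[OF \<rho>] by (auto simp: W_def)
      moreover have "f y \<in> V" if "y \<in> W" for y
      proof (rule e(2))
        have "\<bar>f (y - x)\<bar> \<le> d * \<rho> (y - x)" by (rule d)
        also have "\<dots> < e" using that d(2) by (simp add: W_def field_simps)
        finally show "\<bar>f y - f x\<bar> < e" by (simp add: linear_diff[OF f])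
      qed
      ultimately show ?thesis using openin_subset[of ?T W] by (intro exI[of _ W]) auto
    qed
    then show "openin ?T {x \<in> topspace ?T. f x \<in> V}"
      by (subst openin_subopen) simp
  qed auto
qed

section \<open>Roots near the unit element\<close>

text \<open>The linear part of \<open>z \<mapsto> (1 - z) ^ m\<close> at \<open>0\<close> is \<open>- m z\<close>, and the rest is Lipschitz on the
  ball of radius \<open>\<delta>\<close> with a constant that vanishes as \<open>\<delta>\<close> tends to \<open>0\<close>. Only the
  deviation of a power from \<open>1\<close> is estimated, never the power itself, so the constant does not
  involve \<open>\<rho> 1\<close>.\<close>

lemma one_minus_power_expansion:
  fixes z w :: "'a::{real_algebra, comm_ring, comm_monoid_mult}"
  assumes "submultiplicative_seminorm \<rho>" and z: "\<rho> z \<le> \<delta>" and w: "\<rho> w \<le> \<delta>"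
  shows "\<rho> ((1 - z) ^ m - (1 - w) ^ m + real m *\<^sub>R (z - w))
    \<le> real m * ((1 + \<delta>) ^ m - 1) * \<rho> (z - w)"
proof -
  have \<rho>: "seminorm \<rho>" and mult: "\<And>x y. \<rho> (x * y) \<le> \<rho> x * \<rho> y"
    using assms(1) by (auto simp: submultiplicative_seminorm_def)
  note sn = seminormD[OF \<rho>]
  have \<delta>: "\<delta> \<ge> 0" using sn(1)[of z] z by linarith
  have near1: "\<rho> (1 - (1 - w) ^ k) \<le> (1 + \<delta>) ^ k - 1" for k
  proof (induction k)
    case 0 then show ?case using sn(4) by simp
  next
    case (Suc k)
    let ?u = "1 - (1 - w) ^ k"
    have "1 - (1 - w) ^ Suc k = ?u + w - w * ?u" by (simp add: algebra_simps)
    moreover have "\<rho> (u + w - w * u) \<le> \<rho> u + \<rho> w + \<rho> w * \<rho> u" for u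
      using sn(6)[of "u + w" "w * u"] sn(3)[of u w] mult[of w u] by linarith
    ultimately have "\<rho> (1 - (1 - w) ^ Suc k) \<le> \<rho> ?u + \<rho> w + \<rho> w * \<rho> ?u"
      by metis
    also have "\<dots> \<le> ((1 + \<delta>) ^ k - 1) + \<delta> + \<delta> * ((1 + \<delta>) ^ k - 1)"
      using Suc w \<delta> sn(1) by (intro add_mono mult_mono) auto
    also have "\<dots> = (1 + \<delta>) ^ Suc k - 1" by (simp add: algebra_simps)
    finally show ?case .
  qed
  show ?thesis
  proof (induction m)
    case 0 then show ?case using sn(4) by simp
  next
    case (Suc m)
    let ?X = "(1 - z) ^ m - (1 - w) ^ m" and ?D = "\<rho> (z - w)"
    let ?Y = "?X + real m *\<^sub>R (z - w)" and ?q = "(1 + \<delta>) ^ m - 1"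
    let ?e = "real m * ?q"
    have q: "?q \<ge> 0" using \<delta> by simp
    have D: "?D \<ge> 0" by (rule sn(1))
    have "\<rho> ?X \<le> \<rho> ?Y + real m * ?D"
      using sn(6)[of ?Y "real m *\<^sub>R (z - w)"] sn(2)[of "real m" "z - w"] by simp
    then have X: "\<rho> ?X \<le> (?e + real m) * ?D" using Suc by (simp add: algebra_simps)
    have eq: "(1 - z) ^ Suc m - (1 - w) ^ Suc m + real (Suc m) *\<^sub>R (z - w)
      = ?Y - z * ?X + (z - w) * (1 - (1 - w) ^ m)"
      by (simp add: algebra_simps)
    have "\<rho> (y - z * x + v * u) \<le> \<rho> y + \<rho> z * \<rho> x + \<rho> v * \<rho> u" for x y u v
      using sn(3)[of "y - z * x" "v * u"] sn(6)[of y "z * x"] mult[of z x] mult[of v u] by linarith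
    then have "\<rho> (?Y - z * ?X + (z - w) * (1 - (1 - w) ^ m)) \<le> \<rho> ?Y + \<rho> z * \<rho> ?X + ?D * \<rho> (1 - (1 - w) ^ m)" .
    also have "\<dots> \<le> ?e * ?D + \<delta> * ((?e + real m) * ?D) + ?D * ?q"
      using Suc X near1[of m] z sn(1) \<delta> D by (intro add_mono mult_mono) auto
    also have "\<dots> = (real m * ((1 + \<delta>) ^ Suc m - 1) + ?q) * ?D"
      by (simp add: algebra_simps)
    also have "\<dots> \<le> (real m * ((1 + \<delta>) ^ Suc m - 1) + ((1 + \<delta>) ^ Suc m - 1)) * ?D"
      using \<delta> D by (intro mult_right_mono add_left_mono) (auto simp: algebra_simps)
    also have "\<dots> = real (Suc m) * ((1 + \<delta>) ^ Suc m - 1) * ?D"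
      by (simp add: algebra_simps)
    finally show ?case unfolding eq .
  qed
qed

text \<open>The equation \<open>(1 - z) ^ n = 1 - x\<close> is solved approximately by the iteration
  \<open>z \<mapsto> z + ((1 - z) ^ n - (1 - x)) / n\<close>, Newton's method with the derivative frozen at \<open>0\<close>. It is a
  contraction near \<open>0\<close>, and each step equals the current error divided by \<open>n\<close>, so the errors tend to
  \<open>0\<close> although \<open>A\<close> need not be complete and the iterates need not converge.\<close>

lemma near_one_limit_of_powers:
  fixes \<rho> :: "'a::{real_algebra, comm_ring, comm_monoid_mult} \<Rightarrow> real"
  assumes sub: "submultiplicative_seminorm \<rho>" and n: "n \<ge> 1"
  shows "\<exists>r>0. \<forall>x. \<rho> x \<le> r \<longrightarrow> (\<exists>y. (\<lambda>k. \<rho> (y k ^ n - (1 - x))) \<longlonglongrightarrow> 0)"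
proof -
  have \<rho>: "seminorm \<rho>"
    using sub by (auto simp: submultiplicative_seminorm_def)
  note sn = seminormD[OF \<rho>]
  have "((\<lambda>\<delta>::real. (1 + \<delta>) ^ n) \<longlongrightarrow> (1 + 0) ^ n) (at_right 0)"
    by (intro tendsto_intros)
  then have "\<forall>\<^sub>F \<delta>::real in at_right 0. (1 + \<delta>) ^ n < 3 / 2"
    by (rule order_tendstoD) simp
  then obtain b :: real where b: "b > 0" "\<And>\<delta>. 0 < \<delta> \<Longrightarrow> \<delta> < b \<Longrightarrow> (1 + \<delta>) ^ n < 3 / 2"
    unfolding eventually_at_right_field by auto
  define \<delta> where "\<delta> = b / 2"
  have \<delta>: "\<delta> > 0" "(1 + \<delta>) ^ n < 3 / 2" using b by (auto simp: \<delta>_def)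
  \<comment> \<open>The first step is at most \<open>r\<close> and the steps are at least halved each time, so their sum stays within \<open>2 * r = \<delta>\<close>.\<close>
  define r where "r = \<delta> / 2"
  have "\<exists>y. (\<lambda>k. \<rho> (y k ^ n - (1 - x))) \<longlonglongrightarrow> 0" if x: "\<rho> x \<le> r" for x
  proof -
    define g where "g z = z + (1 / n) *\<^sub>R ((1 - z) ^ n - (1 - x))" for z
    define z where "z k = (g ^^ k) 0" for k
    have zS: "z (Suc k) = g (z k)" for k by (simp add: z_def)
    have contr: "\<rho> (g u - g v) \<le> \<rho> (u - v) / 2" if "\<rho> u \<le> \<delta>" "\<rho> v \<le> \<delta>" for u v
    proof -
      have "g u - g v = (1 / n) *\<^sub>R ((1 - u) ^ n - (1 - v) ^ n + real n *\<^sub>R (u - v))"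
        using n by (simp add: g_def scaleR_right_distrib scaleR_right_diff_distrib)
      then have "\<rho> (g u - g v) = (1 / n) * \<rho> ((1 - u) ^ n - (1 - v) ^ n + real n *\<^sub>R (u - v))"
        by (simp add: sn(2))
      also have "\<dots> \<le> (1 / n) * (real n * ((1 + \<delta>) ^ n - 1) * \<rho> (u - v))"
        by (intro mult_left_mono one_minus_power_expansion sub that) auto
      also have "\<dots> = ((1 + \<delta>) ^ n - 1) * \<rho> (u - v)" using n by simp
      also have "\<dots> \<le> (1 / 2) * \<rho> (u - v)"
        using \<delta> sn(1) by (intro mult_right_mono) auto
      finally show ?thesis by simp
    qed
    have inv: "\<rho> (z k) \<le> 2 * r * (1 - (1/2) ^ k) \<and> \<rho> (z (Suc k) - z k) \<le> r * (1/2) ^ k" for k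
    proof (induction k)
      case 0
      have "z (Suc 0) - z 0 = (1 / n) *\<^sub>R x" using n by (simp add: z_def g_def)
      then have "\<rho> (z (Suc 0) - z 0) = (1 / n) * \<rho> x" by (simp add: sn(2))
      also have "\<dots> \<le> 1 * \<rho> x" using n sn(1) by (intro mult_right_mono) auto
      finally show ?case using x by (simp add: z_def sn(4))
    next
      case (Suc k)
      have small: "2 * r * (1 - (1/2) ^ j) \<le> \<delta>" for j
        using \<delta>(1) by (simp add: r_def algebra_simps)
      have z1: "\<rho> (z (Suc k)) \<le> 2 * r * (1 - (1/2) ^ Suc k)"
        using Suc sn(3)[of "z (Suc k) - z k" "z k"] by (simp add: algebra_simps)
      have "\<rho> (z (Suc (Suc k)) - z (Suc k)) \<le> \<rho> (z (Suc k) - z k) / 2"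
        unfolding zS[of "Suc k"] zS[of k]
        using order_trans[OF z1 small] order_trans[OF conjunct1[OF Suc] small]
        by (intro contr) (simp_all only: zS)
      then show ?case using z1 Suc by auto
    qed
    have "(1 - z k) ^ n - (1 - x) = real n *\<^sub>R (z (Suc k) - z k)" for k
      using n by (simp add: zS g_def)
    then have upper: "\<rho> ((1 - z k) ^ n - (1 - x)) \<le> real n * (r * (1/2) ^ k)" for k
      using inv[of k] by (simp add: sn(2) mult_left_mono)
    have lim: "(\<lambda>k. real n * (r * (1/2) ^ k)) \<longlonglongrightarrow> 0"
    proof -
      have "(\<lambda>k. (1/2 :: real) ^ k) \<longlonglongrightarrow> 0" by (rule LIMSEQ_realpow_zero) auto
      from tendsto_mult_left[OF this, of "real n * r"] show ?thesis by (simp add: mult.assoc)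
    qed
    have "(\<lambda>k. \<rho> ((1 - z k) ^ n - (1 - x))) \<longlonglongrightarrow> 0"
      by (rule tendsto_sandwich[OF always_eventually always_eventually tendsto_const lim])
        (intro allI sn(1) upper)+
    then have "\<exists>y. (\<lambda>k. \<rho> (y k ^ n - (1 - x))) \<longlonglongrightarrow> 0"
      by (rule exI[of _ "\<lambda>k. 1 - z k"])
    then show ?thesis by blast
  qed
  moreover have "r > 0" using \<delta> by (simp add: r_def)
  ultimately show ?thesis by blast
qed

text \<open>Since \<open>1 - x\<close> is a limit of \<open>n\<close>-th powers for small \<open>x\<close>, the values \<open>\<phi> ((1 - x) * s)\<close> and
  \<open>\<phi> ((1 + x) * s)\<close> are nonnegative. The constant depends only on the radius within which such limits
  exist. In particular it does not depend on \<open>\<phi>\<close>, which is what makes the set of normalized functionals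
  compact.\<close>

lemma positive_functional_bound:
  fixes \<rho> :: "'a::{real_algebra, comm_ring, comm_monoid_mult} \<Rightarrow> real"
  assumes sub: "submultiplicative_seminorm \<rho>" and n: "n \<ge> 1" and S: "power_module n S"
  shows "\<exists>c\<ge>0. \<forall>\<phi> C. linear \<phi> \<longrightarrow> (\<forall>s\<in>S. 0 \<le> \<phi> s) \<longrightarrow> (\<forall>a. \<bar>\<phi> a\<bar> \<le> C * \<rho> a) \<longrightarrow>
    (\<forall>s\<in>S. \<forall>x. \<bar>\<phi> (x * s)\<bar> \<le> c * \<rho> x * \<phi> s)"
proof -
  have \<rho>: "seminorm \<rho>" and mult: "\<And>x y. \<rho> (x * y) \<le> \<rho> x * \<rho> y"
    using sub by (auto simp: submultiplicative_seminorm_def)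
  note sn = seminormD[OF \<rho>]
  obtain r where r: "r > 0" "\<And>x. \<rho> x \<le> r \<Longrightarrow> \<exists>y. (\<lambda>k. \<rho> (y k ^ n - (1 - x))) \<longlonglongrightarrow> 0"
    using near_one_limit_of_powers[OF sub n] by blast
  show ?thesis
  proof (intro exI[of _ "1 / r"] conjI allI impI ballI)
    fix \<phi> C s x
    assume lin: "linear \<phi>" and pos: "\<forall>s\<in>S. 0 \<le> \<phi> s" and bd: "\<forall>a. \<bar>\<phi> a\<bar> \<le> C * \<rho> a" and s: "s \<in> S"
    have key: "\<phi> (u * s) \<le> \<phi> s" if u: "\<rho> u \<le> r" for u
    proof -
      obtain y where y: "(\<lambda>k. \<rho> (y k ^ n - (1 - u))) \<longlonglongrightarrow> 0" using r(2)[OF u] by blast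
      have "- (\<bar>C\<bar> * (\<rho> (y k ^ n - (1 - u)) * \<rho> s)) \<le> \<phi> s - \<phi> (u * s)" for k
      proof -
        have "0 \<le> \<phi> (y k ^ n * s)" using pos S s by (auto simp: power_module_def)
        also have "y k ^ n * s = s - u * s + (y k ^ n - (1 - u)) * s" by (simp add: algebra_simps)
        also have "\<phi> \<dots> = \<phi> s - \<phi> (u * s) + \<phi> ((y k ^ n - (1 - u)) * s)"
          by (simp only: linear_add[OF lin] linear_diff[OF lin])
        finally have 1: "- \<phi> ((y k ^ n - (1 - u)) * s) \<le> \<phi> s - \<phi> (u * s)" by simp
        have "\<bar>\<phi> ((y k ^ n - (1 - u)) * s)\<bar> \<le> C * \<rho> ((y k ^ n - (1 - u)) * s)" using bd by blast
        also have "\<dots> \<le> \<bar>C\<bar> * \<rho> ((y k ^ n - (1 - u)) * s)" using sn(1) by (intro mult_right_mono) auto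
        also have "\<dots> \<le> \<bar>C\<bar> * (\<rho> (y k ^ n - (1 - u)) * \<rho> s)" using mult by (intro mult_left_mono) auto
        finally show ?thesis using 1 by linarith
      qed
      moreover have "(\<lambda>k. - (\<bar>C\<bar> * (\<rho> (y k ^ n - (1 - u)) * \<rho> s))) \<longlonglongrightarrow> - (\<bar>C\<bar> * (0 * \<rho> s))"
        by (intro tendsto_intros y)
      ultimately have "- (\<bar>C\<bar> * (0 * \<rho> s)) \<le> \<phi> s - \<phi> (u * s)"
        by (intro tendsto_upperbound) (auto intro!: always_eventually)
      then show ?thesis by simp
    qed
    \<comment> \<open>Again \<open>\<rho> x\<close> may be \<open>0\<close>, so \<open>x\<close> is scaled into the ball of radius \<open>r\<close> by numbers above it.\<close>
    have "r * \<bar>\<phi> (x * s)\<bar> \<le> t * \<phi> s" if t: "t > \<rho> x" for t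
    proof -
      have t0: "t > 0" using t sn(1)[of x] by linarith
      have b: "\<rho> ((r / t) *\<^sub>R x) \<le> r" using t t0 r(1) by (simp add: sn(2) field_simps)
      then have "\<phi> (((r / t) *\<^sub>R x) * s) \<le> \<phi> s" "\<phi> ((- ((r / t) *\<^sub>R x)) * s) \<le> \<phi> s"
        using key[of "(r / t) *\<^sub>R x"] key[of "- ((r / t) *\<^sub>R x)"] by (simp_all only: sn(5))
      then have "(r / t) * \<bar>\<phi> (x * s)\<bar> \<le> \<phi> s"
        by (simp add: linear_scale[OF lin] linear_neg[OF lin] abs_if)
      then show ?thesis using t0 by (simp add: field_simps)
    qed
    then have "(r * \<bar>\<phi> (x * s)\<bar> \<le> \<rho> x * \<phi> s)"
    proof (cases "\<phi> s = 0")
      case False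
      then have p: "\<phi> s > 0" using pos s by force
      have "r * \<bar>\<phi> (x * s)\<bar> / \<phi> s \<le> t" if "t > \<rho> x" for t
        using \<open>\<And>t. t > \<rho> x \<Longrightarrow> r * \<bar>\<phi> (x * s)\<bar> \<le> t * \<phi> s\<close>[OF that] p by (simp add: field_simps)
      then have "r * \<bar>\<phi> (x * s)\<bar> / \<phi> s \<le> \<rho> x" by (rule dense_ge)
      then show ?thesis using p by (simp add: field_simps)
    next
      case True
      with \<open>\<And>t. t > \<rho> x \<Longrightarrow> r * \<bar>\<phi> (x * s)\<bar> \<le> t * \<phi> s\<close>[of "\<rho> x + 1"] show ?thesis by simp
    qed
    then show "\<bar>\<phi> (x * s)\<bar> \<le> 1 / r * \<rho> x * \<phi> s" using r(1) by (simp add: field_simps)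
  qed (use r in auto)
qed

section \<open>Products of the real line\<close>

text \<open>Products of arbitrarily many copies of a space inherit its separation axioms. The order from
  weak to strong axioms lets each instance generalize the one that countable products of metric
  spaces already provide.\<close>

instance "fun" :: (type, t0_space) t0_space
proof
  fix f g :: "'a \<Rightarrow> 'b" assume "f \<noteq> g"
  then obtain i where i: "f i \<noteq> g i" by (auto simp: fun_eq_iff)
  then obtain U where "open U" "\<not> (f i \<in> U \<longleftrightarrow> g i \<in> U)"
    using t0_space_class.t0_space[OF i] by meson
  moreover from this have "open ((\<lambda>h :: 'a \<Rightarrow> 'b. h i) -` U)" by (intro open_vimage) auto
  ultimately show "\<exists>U. open U \<and> \<not> (f \<in> U \<longleftrightarrow> g \<in> U)"
    by (intro exI[of _ "(\<lambda>h. h i) -` U"]) auto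
qed

instance "fun" :: (type, t1_space) t1_space
proof
  fix f g :: "'a \<Rightarrow> 'b" assume "f \<noteq> g"
  then obtain i where i: "f i \<noteq> g i" by (auto simp: fun_eq_iff)
  then obtain U where "open U" "f i \<in> U" "g i \<notin> U"
    using t1_space_class.t1_space[OF i] by meson
  moreover from this have "open ((\<lambda>h :: 'a \<Rightarrow> 'b. h i) -` U)" by (intro open_vimage) auto
  ultimately show "\<exists>U. open U \<and> f \<in> U \<and> g \<notin> U"
    by (intro exI[of _ "(\<lambda>h. h i) -` U"]) auto
qed

instance "fun" :: (type, t2_space) t2_space
proof
  fix f g :: "'a \<Rightarrow> 'b" assume "f \<noteq> g"
  then obtain i where i: "f i \<noteq> g i" by (auto simp: fun_eq_iff)
  then obtain U V where "open U" "open V" "f i \<in> U" "g i \<in> V" "U \<inter> V = {}"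
    using hausdorff[OF i] by meson
  moreover from this have "open ((\<lambda>h :: 'a \<Rightarrow> 'b. h i) -` U)" "open ((\<lambda>h :: 'a \<Rightarrow> 'b. h i) -` V)"
    by (auto intro!: open_vimage)
  ultimately show "\<exists>U V. open U \<and> open V \<and> f \<in> U \<and> g \<in> V \<and> U \<inter> V = {}"
    by (intro exI[of _ "(\<lambda>h. h i) -` U"] exI[of _ "(\<lambda>h. h i) -` V"]) auto
qed

text \<open>Tychonoff's theorem for the product of the intervals \<open>{- B a..B a}\<close>.\<close>

lemma compact_if_closed_bounded_coordinates:
  fixes C :: "('a \<Rightarrow> real) set"
  assumes "closed C" and bd: "\<And>\<phi> a. \<phi> \<in> C \<Longrightarrow> \<bar>\<phi> a\<bar> \<le> B a"
  shows "compact C"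
proof -
  have "compactin (product_topology (\<lambda>_. euclidean) UNIV) (PiE UNIV (\<lambda>a. {- B a..B a}))"
    by (subst compactin_PiE) auto
  then have "compact (PiE UNIV (\<lambda>a. {- B a..B a}))"
    by (simp add: euclidean_product_topology)
  from compact_Int_closed[OF this \<open>closed C\<close>] have "compact (PiE UNIV (\<lambda>a. {- B a..B a}) \<inter> C)" .
  moreover have "PiE UNIV (\<lambda>a. {- B a..B a}) \<inter> C = C"
    using bd by (auto simp: abs_le_iff minus_le_iff) 
  ultimately show ?thesis by simp
qed

lemma closed_characters: "closed characters"
  unfolding characters_def linear_iff
  by (intro closed_Collect_conj closed_Collect_all closed_Collect_eq)
    (auto intro!: continuous_intros)

section \<open>Extreme points\<close>

text \<open>The argument of Krein and Milman, with coordinates in the role of continuous linear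
  functionals. A face of \<open>C\<close> is a nonempty closed subset that contains the end points of every
  segment of \<open>C\<close> meeting it in the interior of the segment. The points of a face where a given coordinate is least form
  a face again, so on a face that is minimal by Zorn's lemma every coordinate is constant. Starting from the face where the coordinate
  \<open>a\<close> is least gives the minimum property.\<close>

lemma extreme_point_minimizing_coordinate:
  fixes C :: "('a \<Rightarrow> real) set"
  assumes C: "compact C" "C \<noteq> {}"
  shows "\<exists>\<phi>\<in>C. (\<forall>\<psi>\<in>C. \<phi> a \<le> \<psi> a) \<and>
    (\<forall>p\<in>C. \<forall>q\<in>C. \<forall>t. 0 < t \<and> t < 1 \<and> \<phi> = (\<lambda>x. t * p x + (1 - t) * q x) \<longrightarrow> p = \<phi>)"
proof -
  define face where "face F \<longleftrightarrow> F \<subseteq> C \<and> closed F \<and> F \<noteq> {} \<and>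
    (\<forall>\<phi>\<in>F. \<forall>p\<in>C. \<forall>q\<in>C. \<forall>t. 0 < t \<and> t < 1 \<and> \<phi> = (\<lambda>x. t * p x + (1 - t) * q x) \<longrightarrow> p \<in> F \<and> q \<in> F)"
    for F
  define least where "least b F = {\<phi>\<in>F. \<forall>\<psi>\<in>F. \<phi> b \<le> \<psi> b}" for b and F :: "('a \<Rightarrow> real) set"
  have face_sub: "F \<subseteq> C" and face_closed: "closed F" and face_ne: "F \<noteq> {}" if "face F" for F
    using that unfolding face_def by blast+
  have compact: "compact F" if "face F" for F
    using compact_Int_closed[OF C(1) face_closed[OF that]] face_sub[OF that] by (simp add: Int_absorb1)
  have faceD: "p \<in> F" "q \<in> F"
    if "face F" "\<phi> \<in> F" "p \<in> C" "q \<in> C" "0 < t" "t < 1" "\<phi> = (\<lambda>x. t * p x + (1 - t) * q x)"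
    for F \<phi> p q t
    using that unfolding face_def by blast+
  have face_least: "face (least b F)" if F: "face F" for b F
  proof -
    have ne: "F \<noteq> {}" using F by (rule face_ne)
    have cont: "continuous_on F (\<lambda>\<psi>. \<psi> b)"
      by (rule continuous_on_subset[OF continuous_on_product_coordinates]) simp
    obtain m where m: "m \<in> F" "\<forall>\<psi>\<in>F. m b \<le> \<psi> b"
      using continuous_attains_inf[OF compact[OF F] ne cont] by (elim bexE)
    have eq: "least b F = F \<inter> {\<psi>. \<psi> b \<le> m b}"
      using m by (auto simp: least_def intro: order_trans)
    have "p \<in> least b F \<and> q \<in> least b F"
      if \<phi>: "\<phi> \<in> least b F" and pq: "p \<in> C" "q \<in> C" and t: "0 < t" "t < 1"
        and e: "\<phi> = (\<lambda>x. t * p x + (1 - t) * q x)" for \<phi> p q t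
    proof -
      have \<phi>F: "\<phi> \<in> F" "\<phi> b \<le> m b" using \<phi> unfolding eq by blast+
      note F' = faceD[OF F \<phi>F(1) pq t e]
      have 1: "m b \<le> p b" "m b \<le> q b" using F' m by auto
      have 2: "t * p b + (1 - t) * q b \<le> m b" using \<phi>F(2) unfolding e .
      have "t * m b \<le> t * p b" "(1 - t) * m b \<le> (1 - t) * q b"
        using 1 t by (auto intro: mult_left_mono)
      with 2 have "t * p b \<le> t * m b" "(1 - t) * q b \<le> (1 - t) * m b"
        by (auto simp: algebra_simps)
      then show ?thesis using F' t by (simp add: eq)
    qed
    moreover have "closed (least b F)" unfolding eq
      by (intro closed_Int face_closed[OF F] closed_Collect_le) (auto intro!: continuous_intros)
    moreover have "least b F \<subseteq> C" using face_sub[OF F] by (auto simp: least_def)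
    moreover have "m \<in> least b F" using m by (simp add: eq)
    ultimately show ?thesis unfolding face_def[of "least b F"] by blast
  qed
  have "face C" unfolding face_def using C compact_imp_closed by blast
  then have F0: "face (least a C)" by (rule face_least)
  define \<A> where "\<A> = {F. face F \<and> F \<subseteq> least a C}"
  have "\<exists>M\<in>\<A>. \<forall>F\<in>\<A>. F \<subseteq> M \<longrightarrow> F = M"
  proof (rule predicate_Zorn)
    show "partial_order_on \<A> (relation_of (\<lambda>X Y. Y \<subseteq> X) \<A>)"
      by (rule partial_order_on_relation_ofI) auto
    fix \<C> assume "\<C> \<in> Chains (relation_of (\<lambda>X Y. Y \<subseteq> X) \<A>)"
    then have sub: "\<C> \<subseteq> \<A>" and chain: "\<And>X Y. X \<in> \<C> \<Longrightarrow> Y \<in> \<C> \<Longrightarrow> X \<subseteq> Y \<or> Y \<subseteq> X"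
      by (auto simp: Chains_def relation_of_def)
    show "\<exists>u\<in>\<A>. \<forall>X\<in>\<C>. u \<subseteq> X"
    proof (cases "\<C> = {}")
      case True
      then show ?thesis using F0 by (auto simp: \<A>_def)
    next
      case False
      have fin: "\<Inter>\<D> \<in> \<D>" if "finite \<D>" "\<D> \<subseteq> \<C>" "\<D> \<noteq> {}" for \<D>
        using that(1,3,2)
      proof (induction \<D> rule: finite_ne_induct)
        case (insert X \<D>)
        then have "\<Inter>\<D> \<in> \<D>" "X \<subseteq> \<Inter>\<D> \<or> \<Inter>\<D> \<subseteq> X" using chain by auto
        then show ?case by (auto simp: Int_absorb1 Int_absorb2)
      qed auto
      have "C \<inter> \<Inter>\<C> \<noteq> {}"
      proof (rule compact_imp_fip[OF C(1)])
        show "closed T" if "T \<in> \<C>" for T using that sub face_closed by (auto simp: \<A>_def)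
        show "C \<inter> \<Inter>\<D> \<noteq> {}" if "finite \<D>" "\<D> \<subseteq> \<C>" for \<D>
        proof (cases "\<D> = {}")
          case True then show ?thesis using C by simp
        next
          case False
          with fin that sub have "face (\<Inter>\<D>)" by (auto simp: \<A>_def)
          then show ?thesis using face_ne face_sub by blast
        qed
      qed
      then have ne: "\<Inter>\<C> \<noteq> {}" by auto
      have all: "face X" "X \<subseteq> least a C" if "X \<in> \<C>" for X using that sub by (auto simp: \<A>_def)
      have "face (\<Inter>\<C>)" unfolding face_def
      proof (intro conjI ballI allI impI)
        show "\<Inter>\<C> \<subseteq> C" using False all(1) face_sub by blast
        show "closed (\<Inter>\<C>)" using all(1) face_closed by (intro closed_Inter) blast
        show "\<Inter>\<C> \<noteq> {}" by (rule ne)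
        fix \<phi> p q t
        assume *: "\<phi> \<in> \<Inter>\<C>" "p \<in> C" "q \<in> C" "0 < t \<and> t < 1 \<and> \<phi> = (\<lambda>x. t * p x + (1 - t) * q x)"
        have "p \<in> X \<and> q \<in> X" if "X \<in> \<C>" for X
          using faceD[OF all(1)[OF that], of \<phi> p q t] * that by blast
        then show "p \<in> \<Inter>\<C>" "q \<in> \<Inter>\<C>" by auto
      qed
      moreover have "\<Inter>\<C> \<subseteq> least a C" using False all(2) by blast
      ultimately show ?thesis unfolding \<A>_def by blast
    qed
  qed
  then obtain M where MA: "M \<in> \<A>" and "\<forall>F\<in>\<A>. F \<subseteq> M \<longrightarrow> F = M" by (elim bexE)
  moreover from MA have M: "face M" "M \<subseteq> least a C" by (simp_all add: \<A>_def)
  ultimately have min: "F = M" if "face F" "F \<subseteq> M" for F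
    using that by (simp add: \<A>_def)
  have const: "\<phi> b \<le> \<psi> b" if "\<phi> \<in> M" "\<psi> \<in> M" for \<phi> \<psi> b
  proof -
    have "least b M = M" using face_least[OF M(1)] by (rule min) (auto simp: least_def)
    then show ?thesis using that by (auto simp: least_def)
  qed
  then have single: "\<phi> = \<psi>" if "\<phi> \<in> M" "\<psi> \<in> M" for \<phi> \<psi>
    using that by (intro ext antisym) auto
  obtain \<phi> where \<phi>: "\<phi> \<in> M" using face_ne[OF M(1)] by blast
  show ?thesis
  proof (intro bexI[of _ \<phi>] conjI ballI allI impI)
    show "\<phi> \<in> C" using \<phi> face_sub[OF M(1)] by blast
    show "\<phi> a \<le> \<psi> a" if "\<psi> \<in> C" for \<psi> using \<phi> M(2) that by (auto simp: least_def)
    fix p q t assume "p \<in> C" "q \<in> C" "0 < t \<and> t < 1 \<and> \<phi> = (\<lambda>x. t * p x + (1 - t) * q x)"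
    then have "p \<in> M" using faceD(1)[OF M(1) \<phi>, of p q t] by blast
    then show "p = \<phi>" using single \<phi> by blast
  qed
qed

section \<open>Positivity on the spectrum\<close>

lemma characterD:
  assumes "\<alpha> \<in> characters"
  shows "\<alpha> (x + y) = \<alpha> x + \<alpha> y" "\<alpha> (x - y) = \<alpha> x - \<alpha> y" "\<alpha> (r *\<^sub>R x) = r * \<alpha> x"
    "\<alpha> (x * y) = \<alpha> x * \<alpha> y" "\<alpha> 1 = 1" "\<alpha> 0 = 0" "\<alpha> (x ^ n) = \<alpha> x ^ n"
proof -
  have lin: "linear \<alpha>" and mult: "\<And>x y. \<alpha> (x * y) = \<alpha> x * \<alpha> y" and one: "\<alpha> 1 = 1"
    using assms by (auto simp: characters_def)
  show "\<alpha> (x + y) = \<alpha> x + \<alpha> y" "\<alpha> (x - y) = \<alpha> x - \<alpha> y" "\<alpha> (r *\<^sub>R x) = r * \<alpha> x" "\<alpha> 0 = 0"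
    using lin by (simp_all add: linear_add linear_diff linear_scale linear_0)
  show "\<alpha> (x * y) = \<alpha> x * \<alpha> y" "\<alpha> 1 = 1" by (fact mult one)+
  show "\<alpha> (x ^ n) = \<alpha> x ^ n" by (induction n) (simp_all add: mult one)
qed

text \<open>The functionals that are normalized and nonnegative on \<open>S\<close> and obey the uniform bound form
  a compact set \<open>Q\<close>, which contains the normalization of \<open>L\<close> unless \<open>L 1 = 0\<close>, when the bound
  forces \<open>L = 0\<close>. It suffices that an extreme point of
  \<open>Q\<close> is a character: then the least value of the coordinate \<open>a\<close> on \<open>Q\<close> is taken at a point of the spectrum.\<close>

lemma nonneg_on_spectrum_imp_nonneg:
  fixes \<rho> L :: "'a::{real_algebra, comm_ring, comm_monoid_mult} \<Rightarrow> real"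
  assumes sub: "submultiplicative_seminorm \<rho>" and n: "n \<ge> 1" and S: "power_module n S"
    and lin: "linear L" and bd: "\<exists>C. \<forall>a. \<bar>L a\<bar> \<le> C * \<rho> a" and pos: "\<forall>s\<in>S. 0 \<le> L s"
    and a: "\<And>\<alpha>. \<alpha> \<in> nonneg_characters S \<inter> gelfand_spectrum \<rho> \<Longrightarrow> 0 \<le> \<alpha> a"
  shows "0 \<le> L a"
proof -
  have \<rho>: "seminorm \<rho>" and mult: "\<And>x y. \<rho> (x * y) \<le> \<rho> x * \<rho> y"
    using sub by (auto simp: submultiplicative_seminorm_def)
  note sn = seminormD[OF \<rho>]
  have S1: "1 \<in> S" using S by (simp add: power_module_def)
  obtain c where c: "c \<ge> 0" and bound: "\<And>\<phi> C s x. linear \<phi> \<Longrightarrow> (\<forall>s\<in>S. 0 \<le> \<phi> s) \<Longrightarrow>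
    (\<forall>a. \<bar>\<phi> a\<bar> \<le> C * \<rho> a) \<Longrightarrow> s \<in> S \<Longrightarrow> \<bar>\<phi> (x * s)\<bar> \<le> c * \<rho> x * \<phi> s"
    using positive_functional_bound[OF sub n S] by blast
  have bound1: "\<bar>\<phi> x\<bar> \<le> c * \<rho> x * \<phi> 1"
    if "linear \<phi>" "\<forall>s\<in>S. 0 \<le> \<phi> s" "\<forall>a. \<bar>\<phi> a\<bar> \<le> C * \<rho> a" for \<phi> C x
    using bound[OF that S1, of x] by simp
  define Q where "Q = {\<phi>. linear \<phi> \<and> \<phi> 1 = 1 \<and> (\<forall>s\<in>S. 0 \<le> \<phi> s) \<and> (\<forall>x. \<bar>\<phi> x\<bar> \<le> c * \<rho> x)}"
  have Q_scaled: "(\<lambda>x. \<phi> x / \<phi> 1) \<in> Q"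
    if *: "linear \<phi>" "\<forall>s\<in>S. 0 \<le> \<phi> s" "\<forall>a. \<bar>\<phi> a\<bar> \<le> C * \<rho> a" and 1: "\<phi> 1 > 0" for \<phi> C
  proof -
    have "linear (\<lambda>x. \<phi> x / \<phi> 1)"
      by (rule linearI) (simp_all add: linear_add[OF *(1)] linear_scale[OF *(1)] add_divide_distrib)
    moreover have "\<bar>\<phi> x / \<phi> 1\<bar> \<le> c * \<rho> x" for x
      using bound1[OF *, of x] 1 by (simp add: divide_le_eq)
    moreover have "0 \<le> \<phi> s / \<phi> 1" if "s \<in> S" for s
      using *(2) that 1 by simp
    ultimately show ?thesis using 1 by (simp add: Q_def)
  qed
  have "closed Q" unfolding Q_def linear_iff Ball_def
    by (intro closed_Collect_conj closed_Collect_all closed_Collect_imp open_Collect_const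
        closed_Collect_eq closed_Collect_le)
      (auto intro!: continuous_intros)
  then have comp: "compact Q"
    by (rule compact_if_closed_bounded_coordinates[of _ "\<lambda>x. c * \<rho> x"]) (auto simp: Q_def)
  have L1: "L 1 \<ge> 0" using pos S1 by auto
  show ?thesis
  proof (cases "L 1 = 0")
    case True
    obtain C where "\<forall>a. \<bar>L a\<bar> \<le> C * \<rho> a" using bd by blast
    from bound1[OF lin pos this, of a] True show ?thesis by simp
  next
    case False
    then have L1: "L 1 > 0" using L1 by simp
    then have LQ: "(\<lambda>x. L x / L 1) \<in> Q" using Q_scaled[OF lin pos] bd by blast
    then obtain \<phi> where \<phi>: "\<phi> \<in> Q" and least: "\<And>\<psi>. \<psi> \<in> Q \<Longrightarrow> \<phi> a \<le> \<psi> a"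
      and extreme: "\<And>p q t. p \<in> Q \<Longrightarrow> q \<in> Q \<Longrightarrow> 0 < t \<Longrightarrow> t < 1 \<Longrightarrow>
        \<phi> = (\<lambda>x. t * p x + (1 - t) * q x) \<Longrightarrow> p = \<phi>"
      using extreme_point_minimizing_coordinate[OF comp, of a] by blast
    have p1: "\<phi> 1 = 1" and pl: "linear \<phi>" and ppos: "\<forall>s\<in>S. 0 \<le> \<phi> s" and pb: "\<forall>x. \<bar>\<phi> x\<bar> \<le> c * \<rho> x"
      using \<phi> by (auto simp: Q_def)
    have small: "\<phi> (u * x) = \<phi> u * \<phi> x" if u: "c * \<rho> u \<le> 1/2" for u x
    proof -
      have shift: "(\<lambda>x. \<phi> (x + v * x) / (1 + \<phi> v)) \<in> Q \<and> 1 + \<phi> v > 0" if v: "c * \<rho> v \<le> 1/2" for v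
      proof -
        have v1: "\<bar>\<phi> v\<bar> \<le> 1/2" using pb v by (meson order_trans)
        have "linear (\<lambda>x. \<phi> (x + v * x))"
          by (rule linearI)
            (simp_all add: linear_add[OF pl] linear_scale[OF pl] distrib_left)
        moreover have "0 \<le> \<phi> (s + v * s)" if "s \<in> S" for s
        proof -
          have "\<bar>\<phi> (v * s)\<bar> \<le> c * \<rho> v * \<phi> s" using bound[OF pl ppos pb that] .
          also have "\<dots> \<le> 1/2 * \<phi> s" using v ppos that by (intro mult_right_mono) auto
          finally show ?thesis using ppos that by (auto simp: linear_add[OF pl])
        qed
        moreover have "\<bar>\<phi> (x + v * x)\<bar> \<le> (c * (1 + \<rho> v)) * \<rho> x" for x
        proof -
          have "\<bar>\<phi> (x + v * x)\<bar> \<le> c * \<rho> (x + v * x)" using pb by blast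
          also have "\<rho> (x + v * x) \<le> (1 + \<rho> v) * \<rho> x"
            using sn(3)[of x "v * x"] mult[of v x] by (simp add: algebra_simps)
          finally show ?thesis using c by (simp add: mult_left_mono mult.assoc)
        qed
        moreover have "\<phi> (1 + v * 1) = 1 + \<phi> v" by (simp add: linear_add[OF pl] p1)
        ultimately show ?thesis using Q_scaled[of "\<lambda>x. \<phi> (x + v * x)" "c * (1 + \<rho> v)"] v1 by auto
      qed
      have m: "c * \<rho> (- u) \<le> 1/2" using u by (simp add: sn(5))
      note P = shift[OF u] and N = shift[OF m]
      \<comment> \<open>The weights are the values at \<open>1\<close> of the two halves of \<open>\<phi> y = \<phi> (y + u * y) / 2 + \<phi> (y - u * y) / 2\<close>.\<close>
      define t where "t = (1 + \<phi> u) / 2"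
      have t: "0 < t" "t < 1" using P N by (auto simp: t_def linear_neg[OF pl])
      have "\<phi> y = t * (\<phi> (y + u * y) / (1 + \<phi> u)) + (1 - t) * (\<phi> (y + (- u) * y) / (1 + \<phi> (- u)))" for y
      proof -
        have half: "(w / 2) * (z / w) = z / 2" if "w > 0" for w z :: real using that by simp
        have "t * (\<phi> (y + u * y) / (1 + \<phi> u)) = \<phi> (y + u * y) / 2"
          unfolding t_def using P by (intro half) blast
        moreover have "(1 - t) = (1 + \<phi> (- u)) / 2" by (simp add: t_def linear_neg[OF pl] field_simps)
        then have "(1 - t) * (\<phi> (y + (- u) * y) / (1 + \<phi> (- u))) = \<phi> (y + (- u) * y) / 2"
          using N by (simp only:) (intro half, blast)
        moreover have "\<phi> y = \<phi> (y + u * y) / 2 + \<phi> (y + (- u) * y) / 2"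
          by (simp add: linear_add[OF pl] linear_neg[OF pl] linear_diff[OF pl] flip: add_divide_distrib)
        ultimately show ?thesis by (simp only:)
      qed
      from extreme[OF conjunct1[OF P] conjunct1[OF N] t ext[OF this]]
      have "(\<lambda>y. \<phi> (y + u * y) / (1 + \<phi> u)) = \<phi>" .
      from fun_cong[OF this, of x] have "\<phi> x + \<phi> (u * x) = \<phi> x + \<phi> u * \<phi> x"
        using P by (simp add: linear_add[OF pl] field_simps)
      then show ?thesis by simp
    qed
    have pm: "\<phi> (u * x) = \<phi> u * \<phi> x" for u x
    proof -
      \<comment> \<open>A positive factor that scales \<open>u\<close> down to the range of the previous step; both sides are linear in \<open>u\<close>.\<close>
      define r where "r = 1 / (2 * (c * \<rho> u + 1))"
      have cu: "c * \<rho> u \<ge> 0" using c sn(1) by simp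
      then have r: "r > 0" by (simp add: r_def)
      have "c * \<rho> (r *\<^sub>R u) \<le> 1/2" using cu r by (simp add: sn(2)) (simp add: r_def field_simps)
      from small[OF this, of x] show ?thesis using r by (simp add: linear_scale[OF pl])
    qed
    have "\<phi> \<in> nonneg_characters S \<inter> gelfand_spectrum \<rho>"
      using pl p1 pm ppos pb seminorm_continuous_iff_bounded[OF \<rho> pl]
      by (auto simp: nonneg_characters_def gelfand_spectrum_def characters_def)
    then have "0 \<le> \<phi> a" by (rule a)
    also have "\<dots> \<le> L a / L 1" using least[OF LQ] .
    finally show ?thesis using L1 by (simp add: zero_le_divide_iff)
  qed
qed

section \<open>The Gelfand spectrum\<close>

lemma seminorm_power_le:
  fixes \<rho> :: "'a::{real_algebra, comm_ring, comm_monoid_mult} \<Rightarrow> real"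
  assumes "submultiplicative_seminorm \<rho>"
  shows "\<rho> (a ^ Suc k) \<le> \<rho> a ^ Suc k"
proof (induction k)
  case (Suc k)
  have "\<rho> (a * a ^ Suc k) \<le> \<rho> a * \<rho> (a ^ Suc k)"
    using assms by (simp add: submultiplicative_seminorm_def)
  also have "\<dots> \<le> \<rho> a * \<rho> a ^ Suc k"
    using assms by (intro mult_left_mono Suc) (auto simp: submultiplicative_seminorm_def seminorm_def)
  finally show ?case by simp
qed simp

text \<open>Bounds for all powers of an element absorb a multiplicative constant.\<close>

lemma le_if_powers_le_multiple:
  fixes x y c :: real
  assumes "0 \<le> y" and le: "\<And>k. x ^ Suc k \<le> c * y ^ Suc k"
  shows "x \<le> y"
proof (rule ccontr)
  assume "\<not> x \<le> y"
  then have x: "x > 0" "y / x < 1" "0 \<le> y / x" using assms(1) by auto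
  have "(\<lambda>k. c * (y / x) ^ Suc k) \<longlonglongrightarrow> c * 0"
    using x by (intro tendsto_mult_left LIMSEQ_Suc LIMSEQ_realpow_zero)
  moreover have "1 \<le> c * (y / x) ^ Suc k" for k
    using le[of k] x(1) by (simp add: power_divide field_simps)
  ultimately have "1 \<le> c * 0" by (intro LIMSEQ_le_const) auto
  then show False by simp
qed

text \<open>A continuous character satisfies \<open>\<bar>\<alpha> a\<bar> \<le> c * \<rho> a\<close> for some \<open>c\<close>; applied to the powers of
  \<open>a\<close>, multiplicativity removes the constant.\<close>

lemma gelfand_spectrum_eq:
  assumes sub: "submultiplicative_seminorm \<rho>"
  shows "gelfand_spectrum \<rho> = characters \<inter> {\<alpha>. \<forall>a. \<bar>\<alpha> a\<bar> \<le> \<rho> a}"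
proof -
  have \<rho>: "seminorm \<rho>" using sub by (simp add: submultiplicative_seminorm_def)
  have "\<bar>\<alpha> a\<bar> \<le> \<rho> a" if "\<alpha> \<in> characters" and c: "\<And>a. \<bar>\<alpha> a\<bar> \<le> c * \<rho> a" for \<alpha> a c
  proof (rule le_if_powers_le_multiple)
    show "0 \<le> \<rho> a" using \<rho> by (simp add: seminorm_def)
    fix k
    have "\<alpha> (a ^ j) = \<alpha> a ^ j" for j
      using that(1) by (induction j) (auto simp: characters_def)
    then have "\<bar>\<alpha> a\<bar> ^ Suc k = \<bar>\<alpha> (a ^ Suc k)\<bar>" by (metis power_abs)
    also have "\<dots> \<le> c * \<rho> (a ^ Suc k)" by (rule c)
    also have "\<dots> \<le> \<bar>c\<bar> * \<rho> (a ^ Suc k)"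
      using \<rho> by (intro mult_right_mono) (auto simp: seminorm_def)
    also have "\<dots> \<le> \<bar>c\<bar> * \<rho> a ^ Suc k"
      by (intro mult_left_mono seminorm_power_le[OF sub]) auto
    finally show "\<bar>\<alpha> a\<bar> ^ Suc k \<le> \<bar>c\<bar> * \<rho> a ^ Suc k" .
  qed
  moreover have "linear \<alpha>" if "\<alpha> \<in> characters" for \<alpha> :: "'a \<Rightarrow> real"
    using that by (simp add: characters_def)
  moreover have "\<exists>c. \<forall>a. \<bar>\<alpha> a\<bar> \<le> c * \<rho> a" if "\<forall>a. \<bar>\<alpha> a\<bar> \<le> \<rho> a" for \<alpha>
    using that by (intro exI[of _ 1]) simp
  ultimately show ?thesis
    unfolding gelfand_spectrum_def using seminorm_continuous_iff_bounded[OF \<rho>] by blast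
qed

lemma compact_gelfand_spectrum:
  assumes "submultiplicative_seminorm \<rho>"
  shows "compact (gelfand_spectrum \<rho>)"
proof (rule compact_if_closed_bounded_coordinates)
  show "closed (gelfand_spectrum \<rho>)" unfolding gelfand_spectrum_eq[OF assms]
    by (intro closed_Int closed_characters closed_Collect_all closed_Collect_le)
      (auto intro!: continuous_intros)
  show "\<bar>\<alpha> a\<bar> \<le> \<rho> a" if "\<alpha> \<in> gelfand_spectrum \<rho>" for \<alpha> a
    using that unfolding gelfand_spectrum_eq[OF assms] by blast
qed

lemma closed_nonneg_characters: "closed (nonneg_characters S)"
proof -
  have "nonneg_characters S = characters \<inter> {\<alpha>. \<forall>a. a \<in> S \<longrightarrow> 0 \<le> \<alpha> a}"
    by (auto simp: nonneg_characters_def)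
  moreover have "closed {\<alpha>. \<forall>a. a \<in> S \<longrightarrow> 0 \<le> (\<alpha> :: 'a \<Rightarrow> real) a}"
    by (intro closed_Collect_all closed_Collect_imp open_Collect_const closed_Collect_le)
      (auto intro!: continuous_intros)
  ultimately show ?thesis by (simp add: closed_Int closed_characters)
qed

section \<open>Representing measures of positive functionals\<close>

text \<open>The evaluations of elements of the algebra form a point-separating algebra of continuous
  functions on \<open>K\<close>, so this is the separation lemma on which the Stone-Weierstrass theorem rests. It takes
  the place of Urysohn functions below.\<close>

lemma separating_element:
  fixes K :: "('a::{real_algebra, comm_ring, comm_monoid_mult} \<Rightarrow> real) set"
  assumes K: "compact K" "K \<subseteq> characters"
    and C: "closed C" "C \<subseteq> K" and D: "closed D" "D \<subseteq> K" and "C \<inter> D = {}"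
    and e: "0 < e" "e < 1"
  shows "\<exists>b. (\<forall>\<alpha>\<in>K. 0 \<le> \<alpha> b \<and> \<alpha> b \<le> 1) \<and> (\<forall>\<alpha>\<in>C. \<alpha> b < e) \<and> (\<forall>\<alpha>\<in>D. 1 - e < \<alpha> b)"
proof -
  define R where "R = {f. \<exists>a. \<forall>\<alpha>\<in>K. f \<alpha> = \<alpha> a}"
  have RI: "f \<in> R" if "\<And>\<alpha>. \<alpha> \<in> characters \<Longrightarrow> \<alpha> \<in> K \<Longrightarrow> f \<alpha> = \<alpha> a" for f a
    using that K by (auto simp: R_def)
  interpret function_ring_on R K
  proof
    show "compact K" by (rule K)
    show "continuous_on K f" if f: "f \<in> R" for f
    proof -
      obtain a where "\<forall>\<alpha>\<in>K. f \<alpha> = \<alpha> a" using f by (auto simp: R_def)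
      then show ?thesis
        using continuous_on_subset[OF continuous_on_product_coordinates[of a] subset_UNIV, of K]
          continuous_on_cong[OF refl, of K f "\<lambda>\<alpha>. \<alpha> a"] by auto
    qed
    show "(\<lambda>\<alpha>. f \<alpha> + g \<alpha>) \<in> R" "(\<lambda>\<alpha>. f \<alpha> * g \<alpha>) \<in> R" if fg: "f \<in> R" "g \<in> R" for f g
    proof -
      obtain a b where ab: "\<forall>\<alpha>\<in>K. f \<alpha> = \<alpha> a" "\<forall>\<alpha>\<in>K. g \<alpha> = \<alpha> b" using fg by (auto simp: R_def)
      show "(\<lambda>\<alpha>. f \<alpha> + g \<alpha>) \<in> R" by (rule RI[of _ "a + b"]) (simp add: ab characterD)
      show "(\<lambda>\<alpha>. f \<alpha> * g \<alpha>) \<in> R" by (rule RI[of _ "a * b"]) (simp add: ab characterD)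
    qed
    show "(\<lambda>_. r) \<in> R" for r by (rule RI[of _ "r *\<^sub>R 1"]) (simp add: characterD)
    fix \<alpha> \<beta> assume "\<alpha> \<in> K" "\<beta> \<in> K" "\<alpha> \<noteq> \<beta>"
    then obtain a where a: "\<alpha> a \<noteq> \<beta> a" by (auto simp: fun_eq_iff)
    have "(\<lambda>\<alpha>. \<alpha> a) \<in> R" by (rule RI) (rule refl)
    then show "\<exists>f\<in>R. f \<alpha> \<noteq> f \<beta>" by (rule bexI[rotated]) (rule a)
  qed
  obtain f where f: "f \<in> R" "f ` K \<subseteq> {0..1}" "\<forall>\<alpha>\<in>C. f \<alpha> < e" "\<forall>\<alpha>\<in>D. f \<alpha> > 1 - e"
    using two[OF C D \<open>C \<inter> D = {}\<close> e] by blast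
  then obtain b where "\<forall>\<alpha>\<in>K. f \<alpha> = \<alpha> b" by (auto simp: R_def)
  with f C(2) D(2) show ?thesis by (intro exI[of _ b]) (force simp: subset_iff)
qed

text \<open>The setting of the Riesz representation theorem, for the algebra in place of all continuous functions.\<close>

locale positive_on_characters =
  fixes K :: "('a::{real_algebra, comm_ring, comm_monoid_mult} \<Rightarrow> real) set" and L :: "'a \<Rightarrow> real"
  assumes compact_K: "compact K" and K_characters: "K \<subseteq> characters" and linear_L: "linear L"
    and L_nonneg: "(\<And>\<alpha>. \<alpha> \<in> K \<Longrightarrow> 0 \<le> \<alpha> a) \<Longrightarrow> 0 \<le> L a"
begin

lemmas char = characterD[OF subsetD[OF K_characters]]
lemmas L_simps = linear_add[OF linear_L] linear_diff[OF linear_L] linear_scale[OF linear_L] linear_0[OF linear_L]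

lemma L_mono: "(\<And>\<alpha>. \<alpha> \<in> K \<Longrightarrow> \<alpha> a \<le> \<alpha> b) \<Longrightarrow> L a \<le> L b"
  using L_nonneg[of "b - a"] by (simp add: char L_simps)

text \<open>For \<open>c = 1\<close> this is the usual content of a compact set in the construction of Riesz measures.
  For general \<open>c\<close>, nonnegative on \<open>K\<close>, it stands for the integral of \<open>c\<close> over \<open>C\<close>; the additional generality
  serves to evaluate integrals later.\<close>

definition compact_content :: "'a \<Rightarrow> ('a \<Rightarrow> real) set \<Rightarrow> real" where
  "compact_content c C = Inf (L ` {b. (\<forall>\<alpha>\<in>K. 0 \<le> \<alpha> b) \<and> (\<forall>\<alpha>\<in>C. \<alpha> c \<le> \<alpha> b)})"

lemma compact_content_le:
  assumes "\<And>\<alpha>. \<alpha> \<in> K \<Longrightarrow> 0 \<le> \<alpha> b" "\<And>\<alpha>. \<alpha> \<in> C \<Longrightarrow> \<alpha> c \<le> \<alpha> b"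
  shows "compact_content c C \<le> L b"
  unfolding compact_content_def using assms
  by (intro cInf_lower bdd_belowI[of _ 0]) (auto intro: L_nonneg)

lemma compact_content_greatest:
  assumes c: "\<forall>\<alpha>\<in>K. 0 \<le> \<alpha> c" and C: "C \<subseteq> K"
    and "\<And>b. (\<And>\<alpha>. \<alpha> \<in> K \<Longrightarrow> 0 \<le> \<alpha> b) \<Longrightarrow> (\<And>\<alpha>. \<alpha> \<in> C \<Longrightarrow> \<alpha> c \<le> \<alpha> b) \<Longrightarrow> x \<le> L b"
  shows "x \<le> compact_content c C"
  unfolding compact_content_def using assms by (intro cInf_greatest) auto

lemma compact_content_nonneg:
  assumes "\<forall>\<alpha>\<in>K. 0 \<le> \<alpha> c" "C \<subseteq> K"
  shows "0 \<le> compact_content c C"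
  using assms by (rule compact_content_greatest) (auto intro: L_nonneg)

lemma compact_content_K: 
  assumes "\<forall>\<alpha>\<in>K. 0 \<le> \<alpha> c"
  shows "compact_content c K = L c"
  using compact_content_le[of c K c] compact_content_greatest[of c K "L c"] assms L_mono
  by (auto intro!: antisym)

lemma compact_content_empty: "compact_content c {} \<le> 0"
  using compact_content_le[of 0 "{}" c] by (simp add: char L_simps)

lemma compact_content_mono:
  assumes "\<forall>\<alpha>\<in>K. 0 \<le> \<alpha> c" "C \<subseteq> D" "D \<subseteq> K"
  shows "compact_content c C \<le> compact_content c D"
  using assms(1,3) by (rule compact_content_greatest) (use assms(2) in \<open>auto intro!: compact_content_le\<close>)

lemma compact_content_subadditive:
  assumes c: "\<forall>\<alpha>\<in>K. 0 \<le> \<alpha> c" and C: "C \<subseteq> K" and D: "D \<subseteq> K"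
  shows "compact_content c (C \<union> D) \<le> compact_content c C + compact_content c D"
proof -
  have "compact_content c (C \<union> D) - compact_content c D \<le> compact_content c C"
  proof (rule compact_content_greatest[OF c C])
    fix b assume b: "\<And>\<alpha>. \<alpha> \<in> K \<Longrightarrow> 0 \<le> \<alpha> b" "\<And>\<alpha>. \<alpha> \<in> C \<Longrightarrow> \<alpha> c \<le> \<alpha> b"
    have "compact_content c (C \<union> D) - L b \<le> compact_content c D"
    proof (rule compact_content_greatest[OF c D])
      fix b' assume b': "\<And>\<alpha>. \<alpha> \<in> K \<Longrightarrow> 0 \<le> \<alpha> b'" "\<And>\<alpha>. \<alpha> \<in> D \<Longrightarrow> \<alpha> c \<le> \<alpha> b'"
      have "compact_content c (C \<union> D) \<le> L (b + b')"
      proof (rule compact_content_le)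
        show "0 \<le> \<alpha> (b + b')" if "\<alpha> \<in> K" for \<alpha> using that b b' by (simp add: char)
        show "\<alpha> c \<le> \<alpha> (b + b')" if \<alpha>: "\<alpha> \<in> C \<union> D" for \<alpha>
        proof -
          have K: "\<alpha> \<in> K" using \<alpha> C D by blast
          have "\<alpha> c \<le> \<alpha> b \<or> \<alpha> c \<le> \<alpha> b'" using \<alpha> b b' by blast
          then show ?thesis using b(1)[OF K] b'(1)[OF K] K by (auto simp: char)
        qed
      qed
      then show "compact_content c (C \<union> D) - L b \<le> L b'" by (simp add: L_simps)
    qed
    then show "compact_content c (C \<union> D) - compact_content c D \<le> L b" by simp
  qed
  then show ?thesis by simp
qed

text \<open>Multiplying an upper bound \<open>b\<close> of \<open>c\<close> on \<open>C \<union> D\<close> by \<open>1 - g\<close> and by \<open>g\<close>, where \<open>g\<close> is almost \<open>0\<close>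
  on \<open>C\<close> and almost \<open>1\<close> on \<open>D\<close>, splits it into an upper bound on \<open>C\<close> and one on \<open>D\<close>, up to a
  factor \<open>t\<close> close to \<open>1\<close>.\<close>

lemma compact_content_superadditive:
  assumes c: "\<forall>\<alpha>\<in>K. 0 \<le> \<alpha> c" and C: "closed C" "C \<subseteq> K" and D: "closed D" "D \<subseteq> K"
    and disj: "C \<inter> D = {}"
  shows "compact_content c C + compact_content c D \<le> compact_content c (C \<union> D)"
proof (rule compact_content_greatest[OF c])
  show "C \<union> D \<subseteq> K" using C D by blast
  fix b assume b: "\<And>\<alpha>. \<alpha> \<in> K \<Longrightarrow> 0 \<le> \<alpha> b" "\<And>\<alpha>. \<alpha> \<in> C \<union> D \<Longrightarrow> \<alpha> c \<le> \<alpha> b"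
  show "compact_content c C + compact_content c D \<le> L b"
  proof (rule field_le_mult_one_interval)
    fix t :: real assume t: "0 < t" "t < 1"
    obtain g where g: "\<forall>\<alpha>\<in>K. 0 \<le> \<alpha> g \<and> \<alpha> g \<le> 1" "\<forall>\<alpha>\<in>C. \<alpha> g < 1 - t" "\<forall>\<alpha>\<in>D. t < \<alpha> g"
      using separating_element[OF compact_K K_characters C D disj, of "1 - t"] t by auto
    have part: "t * compact_content c E \<le> L (b * h)"
      if E: "E \<subseteq> K" "E \<subseteq> C \<union> D" and h: "\<And>\<alpha>. \<alpha> \<in> K \<Longrightarrow> 0 \<le> \<alpha> h" "\<And>\<alpha>. \<alpha> \<in> E \<Longrightarrow> t \<le> \<alpha> h" for E h
    proof -
      have "compact_content c E \<le> L ((1 / t) *\<^sub>R (b * h))"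
      proof (rule compact_content_le)
        show "0 \<le> \<alpha> ((1 / t) *\<^sub>R (b * h))" if "\<alpha> \<in> K" for \<alpha>
          using that b(1) h(1) t by (simp add: char)
        show "\<alpha> c \<le> \<alpha> ((1 / t) *\<^sub>R (b * h))" if \<alpha>: "\<alpha> \<in> E" for \<alpha>
        proof -
          have K: "\<alpha> \<in> K" using \<alpha> E by blast
          have "\<alpha> c \<le> \<alpha> b" using b(2) \<alpha> E by blast
          moreover have "\<alpha> b * t \<le> \<alpha> b * \<alpha> h" using b(1)[OF K] h(2)[OF \<alpha>] by (rule mult_left_mono[rotated])
          ultimately have "\<alpha> c * t \<le> \<alpha> b * \<alpha> h" using t(1) mult_right_mono[of "\<alpha> c" "\<alpha> b" t] by linarith
          then show ?thesis using K t(1) by (simp add: char field_simps)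
        qed
      qed
      then show ?thesis using t(1) by (simp add: L_simps field_simps)
    qed
    have "t * compact_content c D \<le> L (b * g)"
      using D(2) by (rule part) (use g in \<open>auto intro: less_imp_le\<close>)
    moreover have "t * compact_content c C \<le> L (b * (1 - g))"
      using C(2) by (rule part) (use g C(2) in \<open>auto simp: char subset_iff less_eq_real_def\<close>)
    ultimately show "t * (compact_content c C + compact_content c D) \<le> L b"
      by (simp add: algebra_simps L_simps)
  qed
qed

lemma compact_content_scale_le:
  assumes t: "0 \<le> t" and C: "C \<subseteq> K" and le: "\<And>\<alpha>. \<alpha> \<in> C \<Longrightarrow> t \<le> \<alpha> c" and c: "\<forall>\<alpha>\<in>K. 0 \<le> \<alpha> c"
  shows "t * compact_content 1 C \<le> compact_content c C"
proof (cases "t = 0")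
  case True
  then show ?thesis using compact_content_nonneg[OF c C] by simp
next
  case False
  then have t: "t > 0" using t by simp
  show ?thesis
  proof (rule compact_content_greatest[OF c C])
    fix b assume b: "\<And>\<alpha>. \<alpha> \<in> K \<Longrightarrow> 0 \<le> \<alpha> b" "\<And>\<alpha>. \<alpha> \<in> C \<Longrightarrow> \<alpha> c \<le> \<alpha> b"
    have "compact_content 1 C \<le> L ((1 / t) *\<^sub>R b)"
    proof (rule compact_content_le)
      show "0 \<le> \<alpha> ((1 / t) *\<^sub>R b)" if "\<alpha> \<in> K" for \<alpha> using that b(1) t by (simp add: char)
      show "\<alpha> 1 \<le> \<alpha> ((1 / t) *\<^sub>R b)" if "\<alpha> \<in> C" for \<alpha>
        using that b(2)[OF that] le[OF that] C t by (simp add: char subset_iff)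
    qed
    then show "t * compact_content 1 C \<le> L b" using t by (simp add: L_simps field_simps)
  qed
qed

definition open_content :: "'a \<Rightarrow> ('a \<Rightarrow> real) set \<Rightarrow> ennreal" where
  "open_content c V = (SUP C\<in>{C. compact C \<and> C \<subseteq> V \<inter> K}. ennreal (compact_content c C))"

definition outer_content :: "'a \<Rightarrow> ('a \<Rightarrow> real) set \<Rightarrow> ennreal" where
  "outer_content c E = (INF V\<in>{V. open V \<and> E \<subseteq> V}. open_content c V)"

lemma compact_content_le_open_content: "compact C \<Longrightarrow> C \<subseteq> V \<Longrightarrow> C \<subseteq> K \<Longrightarrow> ennreal (compact_content c C) \<le> open_content c V"
  unfolding open_content_def by (rule SUP_upper) auto

lemma open_content_mono: "V \<subseteq> W \<Longrightarrow> open_content c V \<le> open_content c W"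
  unfolding open_content_def by (rule SUP_subset_mono) auto

lemma open_content_le_iff: "open_content c V \<le> x \<longleftrightarrow> (\<forall>C. compact C \<longrightarrow> C \<subseteq> V \<inter> K \<longrightarrow> ennreal (compact_content c C) \<le> x)"
  unfolding open_content_def by (subst SUP_le_iff) auto

lemma outer_content_le: "open V \<Longrightarrow> E \<subseteq> V \<Longrightarrow> outer_content c E \<le> open_content c V"
  unfolding outer_content_def by (rule INF_lower) auto

lemma le_outer_content: "(\<And>V. open V \<Longrightarrow> E \<subseteq> V \<Longrightarrow> x \<le> open_content c V) \<Longrightarrow> x \<le> outer_content c E"
  unfolding outer_content_def by (rule INF_greatest) auto

lemma outer_content_open: "open V \<Longrightarrow> outer_content c V = open_content c V"
  by (intro antisym outer_content_le le_outer_content open_content_mono) auto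

lemma outer_content_mono: "E \<subseteq> F \<Longrightarrow> outer_content c E \<le> outer_content c F"
  by (rule le_outer_content) (auto intro: outer_content_le)

lemma open_content_disjoint_K: "V \<inter> K = {} \<Longrightarrow> open_content c V = 0"
  unfolding le_zero_eq[symmetric, of "open_content c V"] open_content_le_iff
  using compact_content_empty[of c] by (auto simp: ennreal_eq_0_iff)

text \<open>The sets \<open>C - V\<close> and \<open>C - W\<close> are disjoint and compact; cutting \<open>C\<close> at the level \<open>1/2\<close> of a separating
  element of the algebra leaves each of them on one side only.\<close>

lemma compact_subset_Un_open:
  assumes C: "compact C" "C \<subseteq> K" "C \<subseteq> V \<union> W" and V: "open V" and W: "open W"
  shows "\<exists>C1 C2. compact C1 \<and> compact C2 \<and> C1 \<subseteq> V \<and> C2 \<subseteq> W \<and> C = C1 \<union> C2"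
proof -
  have cl: "closed (C - V)" "closed (C - W)"
    using compact_imp_closed[OF C(1)] V W by (simp_all add: closed_Diff)
  have sub: "C - V \<subseteq> K" "C - W \<subseteq> K" and disj: "(C - V) \<inter> (C - W) = {}" using C by auto
  have half: "0 < (1/2 :: real)" "(1/2 :: real) < 1" by auto
  obtain b where b: "\<forall>\<alpha>\<in>C - V. \<alpha> b < 1/2" "\<forall>\<alpha>\<in>C - W. 1 - 1/2 < \<alpha> b"
    using separating_element[OF compact_K K_characters cl(1) sub(1) cl(2) sub(2) disj half] by (elim exE conjE)
  have "closed {\<alpha> :: 'a \<Rightarrow> real. 1/2 \<le> \<alpha> b}" "closed {\<alpha> :: 'a \<Rightarrow> real. \<alpha> b \<le> 1/2}"
    by (intro closed_Collect_le continuous_on_const continuous_on_product_coordinates)+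
  then have "compact (C \<inter> {\<alpha>. 1/2 \<le> \<alpha> b})" "compact (C \<inter> {\<alpha>. \<alpha> b \<le> 1/2})"
    using C(1) by (auto intro: compact_Int_closed)
  moreover have "C \<inter> {\<alpha>. 1/2 \<le> \<alpha> b} \<subseteq> V" "C \<inter> {\<alpha>. \<alpha> b \<le> 1/2} \<subseteq> W" using b by force+
  moreover have "C = (C \<inter> {\<alpha>. 1/2 \<le> \<alpha> b}) \<union> (C \<inter> {\<alpha>. \<alpha> b \<le> 1/2})" by auto
  ultimately show ?thesis by blast
qed

lemma open_content_Un:
  assumes c: "\<forall>\<alpha>\<in>K. 0 \<le> \<alpha> c" and "open V" "open W"
  shows "open_content c (V \<union> W) \<le> open_content c V + open_content c W"
  unfolding open_content_le_iff
proof (intro allI impI)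
  fix C assume C: "compact C" "C \<subseteq> (V \<union> W) \<inter> K"
  then obtain C1 C2 where *: "compact C1" "compact C2" "C1 \<subseteq> V" "C2 \<subseteq> W" "C = C1 \<union> C2"
    using compact_subset_Un_open[OF C(1) _ _ assms(2,3)] by auto
  then have K: "C1 \<subseteq> K" "C2 \<subseteq> K" using C by auto
  have "ennreal (compact_content c C) \<le> ennreal (compact_content c C1 + compact_content c C2)"
    unfolding \<open>C = C1 \<union> C2\<close> by (intro ennreal_leI compact_content_subadditive c K)
  also have "\<dots> = ennreal (compact_content c C1) + ennreal (compact_content c C2)"
    using c K by (intro ennreal_plus compact_content_nonneg)
  also have "\<dots> \<le> open_content c V + open_content c W"
    using * K by (intro add_mono compact_content_le_open_content)
  finally show "ennreal (compact_content c C) \<le> open_content c V + open_content c W" .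
qed

lemma open_content_UN:
  fixes V :: "nat \<Rightarrow> ('a \<Rightarrow> real) set"
  assumes c: "\<forall>\<alpha>\<in>K. 0 \<le> \<alpha> c" and V: "\<And>i. open (V i)"
  shows "open_content c (\<Union>i. V i) \<le> (\<Sum>i. open_content c (V i))"
  unfolding open_content_le_iff
proof (intro allI impI)
  have fin: "open_content c (\<Union>i\<in>I. V i) \<le> (\<Sum>i\<in>I. open_content c (V i))" if "finite I" for I
    using that
  proof induction
    case empty show ?case by (simp add: open_content_disjoint_K)
  next
    case (insert i I)
    have "open_content c (V i \<union> (\<Union>i\<in>I. V i)) \<le> open_content c (V i) + open_content c (\<Union>i\<in>I. V i)"
      by (rule open_content_Un[OF c]) (auto simp: V)
    also have "\<dots> \<le> open_content c (V i) + (\<Sum>i\<in>I. open_content c (V i))" by (intro add_left_mono insert)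
    finally show ?case using insert by simp
  qed
  fix C assume C: "compact C" "C \<subseteq> (\<Union>i. V i) \<inter> K"
  then obtain I where I: "finite I" "C \<subseteq> (\<Union>i\<in>I. V i)"
    using compactE_image[of C UNIV V] V by auto
  have "ennreal (compact_content c C) \<le> open_content c (\<Union>i\<in>I. V i)"
    using C I by (intro compact_content_le_open_content) auto
  also have "\<dots> \<le> (\<Sum>i\<in>I. open_content c (V i))" by (rule fin[OF I(1)])
  also have "\<dots> \<le> (\<Sum>i. open_content c (V i))"
    using I(1) by (intro sum_le_suminf) auto
  finally show "ennreal (compact_content c C) \<le> (\<Sum>i. open_content c (V i))" .
qed

lemma open_content_UNIV:
  assumes c: "\<forall>\<alpha>\<in>K. 0 \<le> \<alpha> c"
  shows "open_content c UNIV = ennreal (L c)"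
proof (rule antisym)
  show "open_content c UNIV \<le> ennreal (L c)"
    unfolding open_content_le_iff
    using compact_content_mono[OF c _ subset_refl] compact_content_K[OF c] by (auto intro!: ennreal_leI)
  show "ennreal (L c) \<le> open_content c UNIV"
    using compact_content_le_open_content[OF compact_K, of UNIV c] by (simp add: compact_content_K[OF c])
qed

lemma outer_content_finite:
  assumes c: "\<forall>\<alpha>\<in>K. 0 \<le> \<alpha> c"
  shows "outer_content c E < \<infinity>"
proof -
  have "outer_content c E \<le> open_content c UNIV" by (rule outer_content_le) auto
  also have "\<dots> = ennreal (L c)" by (rule open_content_UNIV) (rule c)
  finally show ?thesis by (simp add: order_le_less_trans[OF _ ennreal_less_top])
qed

lemma outer_content_approx:
  assumes "outer_content c E < \<infinity>" "0 < e"
  shows "\<exists>V. open V \<and> E \<subseteq> V \<and> open_content c V \<le> outer_content c E + ennreal e"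
proof -
  have "outer_content c E < outer_content c E + ennreal e"
    using assms by (simp add: less_top)
  then show ?thesis unfolding outer_content_def[of c E] INF_less_iff
    by (auto simp: outer_content_def[symmetric] intro: less_imp_le)
qed

lemma outer_measure_space_outer_content:
  assumes c: "\<forall>\<alpha>\<in>K. 0 \<le> \<alpha> c"
  shows "outer_measure_space (Pow UNIV) (outer_content c)"
  unfolding outer_measure_space_def
proof (intro conjI)
  show "positive (Pow UNIV) (outer_content c)"
    unfolding positive_def by (simp add: outer_content_open open_content_disjoint_K)
  show "increasing (Pow UNIV) (outer_content c)"
    unfolding increasing_def by (simp add: outer_content_mono)
  show "countably_subadditive (Pow UNIV) (outer_content c)"
    unfolding countably_subadditive_def
  proof (intro allI impI)
    fix E :: "nat \<Rightarrow> ('a \<Rightarrow> real) set"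
    show "outer_content c (\<Union>i. E i) \<le> (\<Sum>i. outer_content c (E i))"
    proof (rule ennreal_le_epsilon)
      fix e :: real assume e: "0 < e"
      have "\<exists>V. open V \<and> E i \<subseteq> V \<and> open_content c V \<le> outer_content c (E i) + ennreal (e * (1/2) ^ Suc i)" for i
        using outer_content_finite[OF c] e by (intro outer_content_approx) auto
      then obtain V where V: "\<And>i. open (V i)" "\<And>i. E i \<subseteq> V i"
        "\<And>i. open_content c (V i) \<le> outer_content c (E i) + ennreal (e * (1/2) ^ Suc i)" by metis
      have "outer_content c (\<Union>i. E i) \<le> open_content c (\<Union>i. V i)"
        using V(1,2) by (intro outer_content_le) blast+
      also have "\<dots> \<le> (\<Sum>i. open_content c (V i))" by (rule open_content_UN[OF c V(1)])
      also have "\<dots> \<le> (\<Sum>i. outer_content c (E i) + ennreal (e * (1/2) ^ Suc i))"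
        by (intro suminf_le V(3)) auto
      also have "\<dots> = (\<Sum>i. outer_content c (E i)) + (\<Sum>i. ennreal (e * (1/2) ^ Suc i))"
        by (intro suminf_add[symmetric]) auto
      also have "(\<Sum>i. ennreal (e * (1/2) ^ Suc i)) = ennreal e"
      proof -
        have "(\<lambda>i. e * (1/2) ^ Suc i) sums (e * 1)" by (intro sums_mult power_half_series)
        then show ?thesis using e by (intro suminf_ennreal_eq) auto
      qed
      finally show "outer_content c (\<Union>i. E i) \<le> (\<Sum>i. outer_content c (E i)) + ennreal e" .
    qed
  qed
qed

text \<open>A compact \<open>C\<close> that nearly exhausts \<open>W \<inter> V\<close> and a compact \<open>D\<close> that nearly exhausts \<open>W - C\<close> are
  disjoint, so superadditivity on compact sets bounds the sum of their contents by that of \<open>W\<close>.\<close>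

lemma open_in_lambda_system:
  assumes c: "\<forall>\<alpha>\<in>K. 0 \<le> \<alpha> c" and V: "open V"
  shows "V \<in> lambda_system UNIV (Pow UNIV) (outer_content c)"
proof -
  interpret sigma_algebra UNIV "Pow UNIV :: ('a \<Rightarrow> real) set set" by (rule sigma_algebra_Pow)
  have *: "outer_content c (E \<inter> V) + outer_content c (E - V) = outer_content c E" for E
  proof (rule antisym)
    show "outer_content c (E \<inter> V) + outer_content c (E - V) \<le> outer_content c E"
    proof (rule le_outer_content)
      fix W assume W: "open W" "E \<subseteq> W"
      have "open_content c (W \<inter> V) + outer_content c (E - V) \<le> open_content c W"
      proof -
        have "ennreal (compact_content c C) + outer_content c (E - V) \<le> open_content c W"
          if C: "compact C" "C \<subseteq> W \<inter> V" "C \<subseteq> K" for C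
        proof -
          have o: "open (W - C)" using W C compact_imp_closed by blast
          have D: "ennreal (compact_content c C) + ennreal (compact_content c D) \<le> open_content c W"
            if D: "compact D" "D \<subseteq> (W - C) \<inter> K" for D
          proof -
            have "ennreal (compact_content c C) + ennreal (compact_content c D) = ennreal (compact_content c C + compact_content c D)"
              using c C D by (intro ennreal_plus[symmetric] compact_content_nonneg) auto
            also have "\<dots> \<le> ennreal (compact_content c (C \<union> D))"
              using C D by (intro ennreal_leI compact_content_superadditive c compact_imp_closed) auto
            also have "\<dots> \<le> open_content c W" using C D by (intro compact_content_le_open_content compact_Un) auto
            finally show ?thesis .
          qed
          have "outer_content c (E - V) \<le> open_content c (W - C)" using W C by (intro outer_content_le o) auto
          then have "ennreal (compact_content c C) + outer_content c (E - V) \<le> ennreal (compact_content c C) + open_content c (W - C)"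
            by (rule add_left_mono)
          also have "\<dots> = (SUP D\<in>{D. compact D \<and> D \<subseteq> (W - C) \<inter> K}. ennreal (compact_content c C) + ennreal (compact_content c D))"
            unfolding open_content_def by (intro ennreal_SUP_add_right) auto
          also have "\<dots> \<le> open_content c W" by (intro SUP_least) (use D in auto)
          finally show ?thesis .
        qed
        then have "(SUP C\<in>{C. compact C \<and> C \<subseteq> (W \<inter> V) \<inter> K}. ennreal (compact_content c C) + outer_content c (E - V)) \<le> open_content c W"
          by (intro SUP_least) auto
        then show ?thesis unfolding open_content_def[of c "W \<inter> V"]
          by (subst (asm) ennreal_SUP_add_left) auto
      qed
      moreover have "outer_content c (E \<inter> V) \<le> open_content c (W \<inter> V)" using W V by (intro outer_content_le) auto
      ultimately show "outer_content c (E \<inter> V) + outer_content c (E - V) \<le> open_content c W"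
        by (meson add_right_mono order_trans)
    qed
    have "subadditive (Pow UNIV) (outer_content c)"
      using outer_measure_space_outer_content[OF c]
      by (intro countably_subadditive_subadditive) (auto simp: outer_measure_space_def)
    then have "outer_content c ((E \<inter> V) \<union> (E - V)) \<le> outer_content c (E \<inter> V) + outer_content c (E - V)"
      by (rule subadditiveD) auto
    then show "outer_content c E \<le> outer_content c (E \<inter> V) + outer_content c (E - V)" by (simp add: Int_Diff_Un)
  qed
  then show ?thesis unfolding lambda_system_eq by simp
qed

text \<open>The measure \<open>riesz 1\<close> will represent \<open>L\<close>. The measure \<open>riesz c\<close> plays the role of the measure
  with density \<open>\<alpha> \<mapsto> \<alpha> c\<close> with respect to \<open>riesz 1\<close>; it dominates
  \<open>t\<close> times \<open>riesz 1\<close> wherever \<open>c\<close> is at least \<open>t\<close>, and its total mass is \<open>L c\<close>.\<close>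

definition riesz :: "'a \<Rightarrow> ('a \<Rightarrow> real) measure" where
  "riesz c = measure_of UNIV (sets borel) (outer_content c)"

lemma sets_riesz [simp, measurable_cong]: "sets (riesz c) = sets borel"
  unfolding riesz_def by (metis sets.sets_measure_of_eq space_borel)

lemma space_riesz [simp]: "space (riesz c) = UNIV"
  using sets_eq_imp_space_eq[OF sets_riesz] by simp

lemma emeasure_riesz:
  assumes c: "\<forall>\<alpha>\<in>K. 0 \<le> \<alpha> c" and B: "B \<in> sets borel"
  shows "emeasure (riesz c) B = outer_content c B"
proof -
  let ?M = "lambda_system UNIV (Pow UNIV) (outer_content c)"
  interpret P: sigma_algebra UNIV "Pow UNIV :: ('a \<Rightarrow> real) set set" by (rule sigma_algebra_Pow)
  have ms: "measure_space UNIV ?M (outer_content c)"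
    using P.caratheodory_lemma[OF outer_measure_space_outer_content[OF c]] by simp
  then interpret M: sigma_algebra UNIV ?M by (simp add: measure_space_def)
  have sub: "sets borel \<subseteq> ?M"
    unfolding sets_borel using open_in_lambda_system[OF c] by (intro M.sigma_sets_subset) auto
  show ?thesis unfolding riesz_def
  proof (rule emeasure_measure_of_sigma)
    show "sigma_algebra UNIV (sets (borel :: ('a \<Rightarrow> real) measure))"
      using sets.sigma_algebra_axioms[of borel] by simp
    show "positive (sets borel) (outer_content c)" using ms by (simp add: measure_space_def positive_def)
    show "countably_additive (sets borel) (outer_content c)"
      using ms subset_trans[OF _ sub] subsetD[OF sub]
      unfolding measure_space_def countably_additive_def by blast
    show "B \<in> sets borel" by (rule B)
  qed
qed

lemma finite_measure_riesz:
  assumes "\<forall>\<alpha>\<in>K. 0 \<le> \<alpha> c"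
  shows "finite_measure (riesz c)"
  using outer_content_finite[OF assms, of UNIV] emeasure_riesz[OF assms, of UNIV]
  by (intro finite_measureI) auto

lemma emeasure_riesz_UNIV:
  assumes c: "\<forall>\<alpha>\<in>K. 0 \<le> \<alpha> c"
  shows "emeasure (riesz c) UNIV = ennreal (L c)"
  using emeasure_riesz[OF c, of UNIV] by (simp add: outer_content_open open_content_UNIV[OF c])

lemma borel_K: "K \<in> sets borel"
  using compact_imp_closed[OF compact_K] by (rule borel_closed)

lemma one_nonneg: "\<forall>\<alpha>\<in>K. 0 \<le> \<alpha> 1"
  by (simp add: char)

lemma AE_riesz_in_K:
  assumes c: "\<forall>\<alpha>\<in>K. 0 \<le> \<alpha> c"
  shows "AE \<alpha> in riesz c. \<alpha> \<in> K"
proof (rule AE_I[of _ _ "- K"])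
  have o: "open (- K)" using compact_imp_closed[OF compact_K] by (rule open_Compl)
  then show "emeasure (riesz c) (- K) = 0"
    using emeasure_riesz[OF c, of "- K"] by (simp add: outer_content_open open_content_disjoint_K)
  show "- K \<in> sets (riesz c)" using o by simp
qed auto

lemma riesz_scale_le:
  assumes c: "\<forall>\<alpha>\<in>K. 0 \<le> \<alpha> c" and B: "B \<in> sets borel" and t: "0 \<le> t"
    and le: "\<And>\<alpha>. \<alpha> \<in> B \<Longrightarrow> \<alpha> \<in> K \<Longrightarrow> t \<le> \<alpha> c"
  shows "t * measure (riesz 1) B \<le> measure (riesz c) B"
proof (rule field_le_mult_one_interval)
  fix z :: real assume z: "0 < z" "z < 1"
  interpret one: finite_measure "riesz 1" by (rule finite_measure_riesz[OF one_nonneg])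
  interpret c: finite_measure "riesz c" by (rule finite_measure_riesz[OF c])
  show "z * (t * measure (riesz 1) B) \<le> measure (riesz c) B"
  proof (cases "t = 0")
    case False
    define s where "s = z * t"
    have s: "0 \<le> s" "s < t" using z t False by (auto simp: s_def)
    have "ennreal s * outer_content 1 B \<le> outer_content c B"
    proof (rule le_outer_content)
      fix V assume V: "open V" "B \<subseteq> V"
      \<comment> \<open>The strict inequality with \<open>s < t\<close> makes the set open; the complement of \<open>K\<close> is included since \<open>B\<close> may leave \<open>K\<close>.\<close>
      define W where "W = V \<inter> ({\<alpha>. s < \<alpha> c} \<union> - K)"
      have "open {\<alpha> :: 'a \<Rightarrow> real. s < \<alpha> c}"
        by (intro open_Collect_less continuous_on_const continuous_on_product_coordinates)
      then have "open W" unfolding W_def using V compact_imp_closed[OF compact_K] by auto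
      moreover have "B \<subseteq> W" using V le s by (force simp: W_def)
      ultimately have "ennreal s * outer_content 1 B \<le> ennreal s * open_content 1 W"
        by (intro mult_left_mono outer_content_le) auto
      also have "\<dots> = (SUP C\<in>{C. compact C \<and> C \<subseteq> W \<inter> K}. ennreal s * ennreal (compact_content 1 C))"
        unfolding open_content_def by (rule SUP_mult_left_ennreal)
      also have "\<dots> \<le> open_content c V"
      proof (rule SUP_least)
        fix C assume "C \<in> {C. compact C \<and> C \<subseteq> W \<inter> K}"
        then have C: "compact C" "C \<subseteq> W" "C \<subseteq> K" by auto
        have "ennreal s * ennreal (compact_content 1 C) = ennreal (s * compact_content 1 C)"
          using s by (simp add: ennreal_mult' )
        also have "\<dots> \<le> ennreal (compact_content c C)"
        proof (intro ennreal_leI compact_content_scale_le s(1) C(3) c)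
          show "s \<le> \<alpha> c" if "\<alpha> \<in> C" for \<alpha> using that C by (auto simp: W_def)
        qed
        also have "\<dots> \<le> open_content c V"
          using C by (intro compact_content_le_open_content) (auto simp: W_def)
        finally show "ennreal s * ennreal (compact_content 1 C) \<le> open_content c V" .
      qed
      finally show "ennreal s * outer_content 1 B \<le> open_content c V" .
    qed
    then have "ennreal s * emeasure (riesz 1) B \<le> emeasure (riesz c) B"
      by (simp add: emeasure_riesz[OF c B] emeasure_riesz[OF one_nonneg B])
    then have "s * measure (riesz 1) B \<le> measure (riesz c) B"
      using s(1) by (simp add: one.emeasure_eq_measure c.emeasure_eq_measure flip: ennreal_mult')
    then show ?thesis by (simp add: s_def)
  qed simp
qed

text \<open>On a level set of a simple function below \<open>c\<close>, the value times the \<open>riesz 1\<close> measure is at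
  most the \<open>riesz c\<close> measure. The level sets are disjoint, so the sum is at most the total mass of
  \<open>riesz c\<close>, which is \<open>L c\<close>.\<close>

lemma nn_integral_riesz_le:
  assumes c: "\<forall>\<alpha>\<in>K. 0 \<le> \<alpha> c"
  shows "(\<integral>\<^sup>+\<alpha>. ennreal (\<alpha> c) \<partial>riesz 1) \<le> ennreal (L c)"
  unfolding nn_integral_def
proof (rule SUP_least)
  interpret one: finite_measure "riesz 1" by (rule finite_measure_riesz[OF one_nonneg])
  interpret c: finite_measure "riesz c" by (rule finite_measure_riesz[OF c])
  fix g assume "g \<in> {g. simple_function (riesz 1) g \<and> g \<le> (\<lambda>\<alpha>. ennreal (\<alpha> c))}"
  then have g: "simple_function (riesz 1) g" and le: "\<And>\<alpha>. g \<alpha> \<le> ennreal (\<alpha> c)"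
    by (auto simp: le_fun_def)
  have fin: "finite (range g)" using simple_functionD(1)[OF g] by simp
  have level: "g -` {y} \<in> sets borel" for y using simple_functionD(2)[OF g, of "{y}"] by simp
  have "integral\<^sup>S (riesz 1) g = (\<Sum>y\<in>range g. y * emeasure (riesz 1) (g -` {y}))"
    by (simp add: simple_integral_def)
  also have "\<dots> \<le> (\<Sum>y\<in>range g. emeasure (riesz c) (g -` {y}))"
  proof (rule sum_mono)
    fix y assume "y \<in> range g"
    then obtain \<alpha>0 where "y \<le> ennreal (\<alpha>0 c)" using le by auto
    then obtain t where t: "y = ennreal t" "0 \<le> t"
      by (metis ennreal_cases ennreal_neq_top top.extremum_unique)
    have "t * measure (riesz 1) (g -` {y}) \<le> measure (riesz c) (g -` {y})"
    proof (rule riesz_scale_le[OF c level t(2)])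
      fix \<alpha> assume "\<alpha> \<in> g -` {y}" "\<alpha> \<in> K"
      then have "ennreal t \<le> ennreal (\<alpha> c)" "0 \<le> \<alpha> c" using le[of \<alpha>] c t by auto
      then show "t \<le> \<alpha> c" by (simp add: ennreal_le_iff)
    qed
    then show "y * emeasure (riesz 1) (g -` {y}) \<le> emeasure (riesz c) (g -` {y})"
      using t by (simp add: one.emeasure_eq_measure c.emeasure_eq_measure ennreal_leI flip: ennreal_mult')
  qed
  also have "\<dots> = emeasure (riesz c) (\<Union>y\<in>range g. g -` {y})"
    using fin level by (intro sum_emeasure) (auto simp: disjoint_family_on_def)
  also have "\<dots> \<le> emeasure (riesz c) UNIV"
    by (intro emeasure_mono) auto
  also have "\<dots> = ennreal (L c)" by (rule emeasure_riesz_UNIV[OF c])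
  finally show "integral\<^sup>S (riesz 1) g \<le> ennreal (L c)" .
qed

lemma measurable_evaluation: "(\<lambda>\<alpha>. \<alpha> a) \<in> borel_measurable (riesz c)"
  using borel_measurable_continuous_onI[OF continuous_on_product_coordinates[of a]]
  by (simp add: measurable_cong_sets[OF sets_riesz refl])

lemma evaluation_bounded_on_K: "\<exists>t. \<forall>\<alpha>\<in>K. \<bar>\<alpha> a\<bar> \<le> t"
proof -
  have "compact ((\<lambda>\<alpha>. \<alpha> a) ` K)"
    by (intro compact_continuous_image compact_K continuous_on_subset[OF continuous_on_product_coordinates]) simp
  then obtain t where "\<forall>x\<in>(\<lambda>\<alpha>. \<alpha> a) ` K. norm x \<le> t"
    using compact_imp_bounded bounded_iff by metis
  then show ?thesis by (intro exI[of _ t]) simp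
qed

lemma integrable_riesz: "integrable (riesz 1) (\<lambda>\<alpha>. \<alpha> a)"
proof -
  interpret finite_measure "riesz 1" by (rule finite_measure_riesz[OF one_nonneg])
  obtain t where "\<forall>\<alpha>\<in>K. \<bar>\<alpha> a\<bar> \<le> t" using evaluation_bounded_on_K by blast
  then have "AE \<alpha> in riesz 1. norm (\<alpha> a) \<le> t"
    using AE_riesz_in_K[OF one_nonneg] by (auto elim: eventually_mono)
  then show ?thesis by (rule integrable_const_bound[OF _ measurable_evaluation])
qed

text \<open>Adding a multiple of the unit makes \<open>a\<close> nonnegative on \<open>K\<close>, and both sides agree at the unit.\<close>

lemma integral_riesz_le: "(\<integral>\<alpha>. \<alpha> a \<partial>riesz 1) \<le> L a"
proof -
  interpret finite_measure "riesz 1" by (rule finite_measure_riesz[OF one_nonneg])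
  obtain t where t: "\<forall>\<alpha>\<in>K. \<bar>\<alpha> a\<bar> \<le> t" using evaluation_bounded_on_K by blast
  define c where "c = t *\<^sub>R 1 + a"
  have c_eq: "\<alpha> c = t + \<alpha> a" if "\<alpha> \<in> K" for \<alpha> using that by (simp add: c_def char)
  have c: "\<forall>\<alpha>\<in>K. 0 \<le> \<alpha> c" using t by (fastforce simp: c_eq abs_le_iff)
  have Lc: "0 \<le> L c" using c by (intro L_nonneg) blast
  have AE_c: "AE \<alpha> in riesz 1. 0 \<le> \<alpha> c"
    using AE_riesz_in_K[OF one_nonneg] by eventually_elim (use c in blast)
  have "ennreal (\<integral>\<alpha>. \<alpha> c \<partial>riesz 1) \<le> ennreal (L c)"
    using nn_integral_riesz_le[OF c] nn_integral_eq_integral[OF integrable_riesz AE_c] by simp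
  then have le: "(\<integral>\<alpha>. \<alpha> c \<partial>riesz 1) \<le> L c" using Lc by (simp add: ennreal_le_iff)
  have "AE \<alpha> in riesz 1. \<alpha> c = t + \<alpha> a"
    using AE_riesz_in_K[OF one_nonneg] by eventually_elim (rule c_eq)
  then have "(\<integral>\<alpha>. \<alpha> c \<partial>riesz 1) = (\<integral>\<alpha>. t + \<alpha> a \<partial>riesz 1)"
    by (intro integral_cong_AE measurable_evaluation borel_measurable_add borel_measurable_const)
  also have "\<dots> = measure (riesz 1) UNIV * t + (\<integral>\<alpha>. \<alpha> a \<partial>riesz 1)"
    by (simp add: Bochner_Integration.integral_add[OF integrable_const integrable_riesz])
  also have "measure (riesz 1) UNIV = L 1"
    using emeasure_riesz_UNIV[OF one_nonneg] L_nonneg[of 1] one_nonneg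
    by (simp add: emeasure_eq_measure)
  finally show ?thesis using le by (simp add: c_def L_simps)
qed

text \<open>The inequality holds for \<open>a\<close> and for \<open>- a\<close>.\<close>

lemma integral_riesz: "(\<integral>\<alpha>. \<alpha> a \<partial>riesz 1) = L a"
proof (rule antisym)
  show "(\<integral>\<alpha>. \<alpha> a \<partial>riesz 1) \<le> L a" by (rule integral_riesz_le)
  have "AE \<alpha> in riesz 1. \<alpha> (0 - a) = - \<alpha> a"
    using AE_riesz_in_K[OF one_nonneg] by eventually_elim (simp add: char del: diff_0)
  then have "(\<integral>\<alpha>. \<alpha> (0 - a) \<partial>riesz 1) = (\<integral>\<alpha>. - \<alpha> a \<partial>riesz 1)"
    by (intro integral_cong_AE measurable_evaluation borel_measurable_uminus)
  with integral_riesz_le[of "0 - a"] show "L a \<le> (\<integral>\<alpha>. \<alpha> a \<partial>riesz 1)"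
    by (simp only: L_simps Bochner_Integration.integral_minus)
qed

text \<open>Outer regularity is built into the outer content; for a finite measure carried by a compact set, it gives inner
  regularity by taking complements.\<close>

lemma riesz_inner_regular:
  assumes B: "B \<in> sets borel" and e: "0 < e"
  shows "\<exists>C. compact C \<and> C \<subseteq> B \<and> C \<subseteq> K \<and> emeasure (riesz 1) B \<le> emeasure (riesz 1) C + ennreal e"
proof -
  interpret finite_measure "riesz 1" by (rule finite_measure_riesz[OF one_nonneg])
  obtain V where V: "open V" "- B \<subseteq> V" "open_content 1 V \<le> outer_content 1 (- B) + ennreal e"
    using outer_content_approx[OF outer_content_finite[OF one_nonneg] e] by blast
  have VB: "V \<in> sets borel" "- B \<in> sets borel" using V(1) B by (auto simp: Compl_eq_Diff_UNIV)
  have "emeasure (riesz 1) V \<le> emeasure (riesz 1) (- B) + ennreal e"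
    using V emeasure_riesz[OF one_nonneg] VB by (simp add: outer_content_open)
  then have le: "measure (riesz 1) V \<le> measure (riesz 1) (- B) + e"
    using e by (simp add: emeasure_eq_measure flip: ennreal_plus)
  define C where "C = K - V"
  have C: "compact C" "C \<subseteq> B" "C \<subseteq> K"
    using compact_K V by (auto simp: C_def compact_diff)
  have CB: "C \<in> sets borel" using compact_imp_closed[OF C(1)] by (rule borel_closed)
  have "measure (riesz 1) B \<le> measure (riesz 1) (C \<union> (V \<inter> B) \<union> - K)"
    using B VB CB borel_K by (intro finite_measure_mono) (auto simp: C_def Compl_eq_Diff_UNIV)
  also have "\<dots> \<le> measure (riesz 1) C + measure (riesz 1) (V \<inter> B) + measure (riesz 1) (- K)"
    using B VB CB borel_K
    by (intro order_trans[OF measure_Un_le] add_mono measure_Un_le)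
      (auto simp: Compl_eq_Diff_UNIV)
  also have "measure (riesz 1) (- K) = 0"
    using AE_riesz_in_K[OF one_nonneg] borel_K
    by (subst (asm) AE_iff_measurable[of "- K"]) (auto simp: Compl_eq_Diff_UNIV measure_def)
  also have "measure (riesz 1) (V \<inter> B) = measure (riesz 1) V - measure (riesz 1) (- B)"
  proof -
    have "measure (riesz 1) (V - (- B)) = measure (riesz 1) V - measure (riesz 1) (- B)"
      using VB V(2) by (intro finite_measure_Diff) auto
    then show ?thesis by (simp add: Diff_Compl)
  qed
  finally have "measure (riesz 1) B \<le> measure (riesz 1) C + e" using le by simp
  then have "emeasure (riesz 1) B \<le> emeasure (riesz 1) C + ennreal e"
    using e by (simp add: emeasure_eq_measure flip: ennreal_plus)
  with C show ?thesis by blast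
qed

end

section \<open>Radon measures on the character space\<close>

lemma topspace_character_topology [simp]: "topspace character_topology = characters"
  by (simp add: character_topology_def)

lemma Hausdorff_character_topology: "Hausdorff_space character_topology"
proof -
  have "Hausdorff_space (euclidean :: ('a \<Rightarrow> real) topology)"
    unfolding Hausdorff_space_def disjnt_def using hausdorff by (simp, metis)
  then show ?thesis unfolding character_topology_def by (rule Hausdorff_space_subtopology)
qed

lemma compactin_character_topology: "compactin character_topology C \<longleftrightarrow> compact C \<and> C \<subseteq> characters"
  by (simp add: character_topology_def compactin_subtopology)

lemma openin_character_topology: "openin character_topology U \<longleftrightarrow> (\<exists>V. open V \<and> U = characters \<inter> V)"
  by (simp add: character_topology_def openin_open)

lemma sets_borel_character_topology:
  "sets (borel_sigma character_topology) = sets (restrict_space borel characters)"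
proof -
  have "characters \<in> sigma_sets UNIV {V :: ('a \<Rightarrow> real) set. open V}"
    using borel_closed[OF closed_characters] unfolding sets_borel .
  from sigma_sets_Int[OF this] have
    "sets (restrict_space borel characters) = sigma_sets characters ((\<inter>) characters ` {V :: ('a \<Rightarrow> real) set. open V})"
    by (simp add: sets_restrict_space sets_borel)
  moreover have "(\<inter>) characters ` {V :: ('a \<Rightarrow> real) set. open V} = {U. openin character_topology U}"
    by (auto simp: openin_character_topology)
  moreover have "sets (borel_sigma character_topology) = sigma_sets characters {U :: ('a \<Rightarrow> real) set. openin character_topology U}"
    unfolding borel_sigma_def using openin_subset[of character_topology]
    by (subst sets_measure_of) auto
  ultimately show ?thesis by simp
qed

lemma sets_borel_character_topology_iff:
  "B \<in> sets (borel_sigma character_topology) \<longleftrightarrow> B \<subseteq> characters \<and> B \<in> sets borel"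
  unfolding sets_borel_character_topology
  using borel_closed[OF closed_characters] by (subst sets_restrict_space_iff) auto

text \<open>The characters form a closed set that contains \<open>K\<close>, so restricting the Riesz measure to them loses
  no mass and keeps its regularity.\<close>

lemma (in positive_on_characters) representing_radon_measure_exists:
  "\<exists>\<mu>. radon_measure character_topology \<mu> \<and> represents \<mu> L \<and> emeasure \<mu> (characters - K) = 0"
proof (intro exI conjI)
  interpret finite_measure "riesz 1" by (rule finite_measure_riesz[OF one_nonneg])
  let ?\<mu> = "restrict_space (riesz 1) characters"
  have ch: "characters \<in> sets borel" by (rule borel_closed[OF closed_characters])
  then have chr: "characters \<inter> space (riesz 1) \<in> sets (riesz 1)" by simp
  have sets: "sets ?\<mu> = sets (borel_sigma character_topology)"
    unfolding sets_borel_character_topology by (simp add: sets_restrict_space)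
  have em: "emeasure ?\<mu> B = emeasure (riesz 1) B" if "B \<subseteq> characters" for B
    using that by (rule emeasure_restrict_space[OF chr])
  show "emeasure ?\<mu> (characters - K) = 0"
  proof -
    have "emeasure ?\<mu> (characters - K) = emeasure (riesz 1) (characters - K)" by (rule em) auto
    also have "\<dots> \<le> emeasure (riesz 1) (- K)"
      using borel_K by (intro emeasure_mono) (auto simp: Compl_eq_Diff_UNIV)
    also have "emeasure (riesz 1) (- K) = 0"
      using AE_riesz_in_K[OF one_nonneg] borel_K
      by (subst (asm) AE_iff_measurable[of "- K"]) (auto simp: Compl_eq_Diff_UNIV)
    finally show ?thesis by simp
  qed
  show "radon_measure character_topology ?\<mu>"
    unfolding radon_measure_def
  proof (intro conjI ballI)
    show "Hausdorff_space (character_topology :: ('a \<Rightarrow> real) topology)" by (rule Hausdorff_character_topology)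
    show "sets ?\<mu> = sets (borel_sigma character_topology)" by (rule sets)
    show "\<exists>U. openin character_topology U \<and> \<alpha> \<in> U \<and> emeasure ?\<mu> U < \<infinity>"
      if "\<alpha> \<in> topspace character_topology" for \<alpha>
      using that by (intro exI[of _ characters])
        (auto simp: em openin_character_topology less_top[symmetric])
    fix B assume "B \<in> sets ?\<mu>"
    then have B: "B \<subseteq> characters" "B \<in> sets borel"
      unfolding sets sets_borel_character_topology_iff by blast+
    show "emeasure ?\<mu> B = (SUP C\<in>{C. compactin character_topology C \<and> C \<subseteq> B}. emeasure ?\<mu> C)" (is "_ = ?S")
    proof (rule antisym)
      show "emeasure ?\<mu> B \<le> ?S"
      proof (rule ennreal_le_epsilon)
        fix e :: real assume "0 < e"
        then obtain C where C: "compact C" "C \<subseteq> B" "emeasure (riesz 1) B \<le> emeasure (riesz 1) C + ennreal e"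
          using riesz_inner_regular[OF B(2)] by blast
        have "emeasure (riesz 1) C \<le> ?S"
          unfolding em[OF order_trans[OF C(2) B(1)], symmetric]
          using C B by (intro SUP_upper) (auto simp: compactin_character_topology)
        then have "emeasure (riesz 1) C + ennreal e \<le> ?S + ennreal e" by (rule add_right_mono)
        with C(3) show "emeasure ?\<mu> B \<le> ?S + ennreal e" unfolding em[OF B(1)] by (rule order_trans)
      qed
      show "?S \<le> emeasure ?\<mu> B"
        using \<open>B \<in> sets ?\<mu>\<close> by (intro SUP_least emeasure_mono) auto
    qed
  qed
  show "represents ?\<mu> L"
    unfolding represents_def
  proof (intro allI conjI)
    fix a
    have AE: "AE \<alpha> in riesz 1. indicator characters \<alpha> *\<^sub>R \<alpha> a = \<alpha> a"
      using AE_riesz_in_K[OF one_nonneg] by eventually_elim (use K_characters in auto)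
    have meas: "(\<lambda>\<alpha>. indicator characters \<alpha> *\<^sub>R \<alpha> a) \<in> borel_measurable (riesz 1)"
      using ch measurable_evaluation by (intro borel_measurable_scaleR borel_measurable_indicator) auto
    show "integrable ?\<mu> (\<lambda>\<alpha>. \<alpha> a)"
      unfolding integrable_restrict_space[OF chr]
      using integrable_cong_AE[OF meas measurable_evaluation AE] integrable_riesz by simp
    show "L a = (\<integral>\<alpha>. \<alpha> a \<partial>?\<mu>)"
      unfolding integral_restrict_space[OF chr]
      using integral_cong_AE[OF meas measurable_evaluation AE] integral_riesz by simp
  qed
qed

lemma radon_measure_character_topologyD:
  assumes "radon_measure character_topology \<mu>"
  shows "B \<in> sets \<mu> \<longleftrightarrow> B \<subseteq> characters \<and> B \<in> sets borel" "space \<mu> = characters"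
    "B \<in> sets \<mu> \<Longrightarrow> emeasure \<mu> B = (SUP C\<in>{C. compact C \<and> C \<subseteq> B}. emeasure \<mu> C)"
proof -
  have sets: "sets \<mu> = sets (borel_sigma character_topology)"
    and reg: "\<forall>B\<in>sets \<mu>. emeasure \<mu> B = (SUP C\<in>{C. compactin character_topology C \<and> C \<subseteq> B}. emeasure \<mu> C)"
    using assms by (auto simp: radon_measure_def)
  show 1: "B \<in> sets \<mu> \<longleftrightarrow> B \<subseteq> characters \<and> B \<in> sets borel" for B
    unfolding sets by (rule sets_borel_character_topology_iff)
  show "space \<mu> = characters"
    using sets_eq_imp_space_eq[OF sets] sets_eq_imp_space_eq[OF sets_borel_character_topology]
    by (simp add: space_restrict_space)
  show "emeasure \<mu> B = (SUP C\<in>{C. compact C \<and> C \<subseteq> B}. emeasure \<mu> C)" if B: "B \<in> sets \<mu>"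
  proof -
    have "{C. compactin character_topology C \<and> C \<subseteq> B} = {C. compact C \<and> C \<subseteq> B}"
      using B unfolding 1 compactin_character_topology by auto
    then show ?thesis using reg B by simp
  qed
qed

text \<open>The unit is integrable, and it evaluates to \<open>1\<close> at every character.\<close>

lemma finite_measure_representing:
  assumes "radon_measure character_topology \<mu>" and "represents \<mu> L"
  shows "finite_measure \<mu>"
proof -
  have "integrable \<mu> (\<lambda>\<alpha>. \<alpha> 1)" using assms(2) by (simp add: represents_def)
  moreover have "integrable \<mu> (\<lambda>\<alpha>. \<alpha> 1) \<longleftrightarrow> integrable \<mu> (\<lambda>_. 1 :: real)"
    using radon_measure_character_topologyD(2)[OF assms(1)]
    by (intro Bochner_Integration.integrable_cong) (auto simp: characterD)
  ultimately have "integrable \<mu> (\<lambda>_. 1 :: real)" by simp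
  then show ?thesis by (intro finite_measureI) (simp add: integrable_iff_bounded)
qed

text \<open>For \<open>t > \<rho> a\<close>, Markov's inequality bounds the measure of \<open>{\<alpha>. t \<le> \<bar>\<alpha> a\<bar>}\<close> by
  \<open>L (a ^ (2 * k)) / t ^ (2 * k) \<le> c * (\<rho> a / t) ^ (2 * k)\<close>, which tends to \<open>0\<close>. So each open condition
  \<open>\<rho> a < \<bar>\<alpha> a\<bar>\<close> holds on a null set only. Uncountably many of them have to be excluded at once, and
  this is where inner regularity enters: a compact set outside the spectrum is covered by finitely many.\<close>

lemma representing_measure_concentrated:
  fixes \<rho> L :: "'a::{real_algebra, comm_ring, comm_monoid_mult} \<Rightarrow> real"
  assumes sub: "submultiplicative_seminorm \<rho>" and bd: "\<And>a. \<bar>L a\<bar> \<le> c * \<rho> a"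
    and radon: "radon_measure character_topology \<mu>" and rep: "represents \<mu> L"
  shows "emeasure \<mu> (characters - gelfand_spectrum \<rho>) = 0"
proof -
  interpret finite_measure \<mu> by (rule finite_measure_representing[OF radon rep])
  note sets = radon_measure_character_topologyD(1)[OF radon] and space = radon_measure_character_topologyD(2)[OF radon]
  have \<rho>0: "0 \<le> \<rho> a" for a using sub by (simp add: submultiplicative_seminorm_def seminorm_def)
  have int: "integrable \<mu> (\<lambda>\<alpha>. \<alpha> a)" "(\<integral>\<alpha>. \<alpha> a \<partial>\<mu>) = L a" for a
    using rep by (auto simp: represents_def)
  define big where "big a t = characters \<inter> {\<alpha>. t \<le> \<bar>\<alpha> a\<bar>}" for t and a :: 'a
  have big_sets: "big a t \<in> sets \<mu>" for a t
  proof -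
    have "closed (big a t)" unfolding big_def
      by (intro closed_Int closed_characters closed_Collect_le continuous_on_const continuous_on_rabs
          continuous_on_product_coordinates)
    then show ?thesis unfolding sets by (simp add: big_def)
  qed
  have big0: "measure \<mu> (big a t) = 0" if t: "t > \<rho> a" for a t
  proof (rule ccontr)
    assume "measure \<mu> (big a t) \<noteq> 0"
    then have m: "measure \<mu> (big a t) > 0" using measure_nonneg[of \<mu> "big a t"] by linarith
    have t0: "t > 0" using t \<rho>0[of a] by linarith
    have "(t\<^sup>2) ^ Suc k \<le> (\<bar>c\<bar> / measure \<mu> (big a t)) * ((\<rho> a)\<^sup>2) ^ Suc k" for k
    proof -
      have even: "x ^ (2 * Suc k) = (x\<^sup>2) ^ Suc k" for x :: real by (rule power_mult)
      have "(t\<^sup>2) ^ Suc k * measure \<mu> (big a t) = (\<integral>\<alpha>. (t\<^sup>2) ^ Suc k * indicator (big a t) \<alpha> \<partial>\<mu>)"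
        using big_sets by simp
      also have "\<dots> \<le> (\<integral>\<alpha>. \<alpha> (a ^ (2 * Suc k)) \<partial>\<mu>)"
      proof (rule integral_mono)
        show "integrable \<mu> (\<lambda>\<alpha>. (t\<^sup>2) ^ Suc k * indicator (big a t) \<alpha>)"
          using big_sets by (intro integrable_mult_right integrable_real_indicator) (auto simp: less_top[symmetric])
        show "integrable \<mu> (\<lambda>\<alpha>. \<alpha> (a ^ (2 * Suc k)))" by (rule int)
        fix \<alpha> assume "\<alpha> \<in> space \<mu>"
        then have "\<alpha> (a ^ (2 * Suc k)) = ((\<alpha> a)\<^sup>2) ^ Suc k"
          unfolding space by (simp only: characterD(7) even)
        moreover have "t\<^sup>2 \<le> (\<alpha> a)\<^sup>2" if "\<alpha> \<in> big a t"
          using that t0 power_mono[of t "\<bar>\<alpha> a\<bar>" 2] by (simp add: big_def)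
        ultimately show "(t\<^sup>2) ^ Suc k * indicator (big a t) \<alpha> \<le> \<alpha> (a ^ (2 * Suc k))"
          by (auto simp: indicator_def simp del: power_Suc intro: power_mono)
      qed
      also have "\<dots> \<le> \<bar>c\<bar> * \<rho> (a ^ (2 * Suc k))"
        using bd[of "a ^ (2 * Suc k)"] mult_right_mono[OF abs_ge_self[of c] \<rho>0[of "a ^ (2 * Suc k)"]]
        unfolding int by linarith
      also have "\<dots> \<le> \<bar>c\<bar> * \<rho> a ^ (2 * Suc k)"
        using seminorm_power_le[OF sub, of a "2 * k + 1"] by (intro mult_left_mono) auto
      finally show ?thesis using m unfolding even by (simp add: field_simps del: power_Suc)
    qed
    then have "t\<^sup>2 \<le> (\<rho> a)\<^sup>2" by (rule le_if_powers_le_multiple[OF zero_le_power2])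
    then have "t \<le> \<rho> a" by (rule power2_le_imp_le) (rule \<rho>0)
    then show False using t by simp
  qed
  define U where "U a = {\<alpha> :: 'a \<Rightarrow> real. \<rho> a < \<bar>\<alpha> a\<bar>}" for a
  have U_open: "open (U a)" for a unfolding U_def
    by (intro open_Collect_less continuous_on_const continuous_on_rabs continuous_on_product_coordinates)
  have U_null: "characters \<inter> U a \<in> null_sets \<mu>" for a
  proof -
    have "characters \<inter> U a = (\<Union>n. big a (\<rho> a + 1 / Suc n))"
    proof (intro equalityI subsetI)
      fix \<alpha> assume \<alpha>: "\<alpha> \<in> characters \<inter> U a"
      then have "0 < \<bar>\<alpha> a\<bar> - \<rho> a" by (simp add: U_def)
      then obtain n where "1 / Suc n < \<bar>\<alpha> a\<bar> - \<rho> a" using nat_approx_posE by blast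
      then show "\<alpha> \<in> (\<Union>n. big a (\<rho> a + 1 / Suc n))" using \<alpha> by (intro UN_I[of n]) (auto simp: big_def)
    next
      fix \<alpha> assume "\<alpha> \<in> (\<Union>n. big a (\<rho> a + 1 / Suc n))"
      then obtain n where n: "\<alpha> \<in> characters" "\<rho> a + 1 / Suc n \<le> \<bar>\<alpha> a\<bar>" by (auto simp: big_def)
      moreover have "0 < 1 / real (Suc n)" by simp
      then have "\<rho> a < \<bar>\<alpha> a\<bar>" using n(2) by linarith
      ultimately show "\<alpha> \<in> characters \<inter> U a" by (simp add: U_def)
    qed
    moreover have "big a (\<rho> a + 1 / Suc n) \<in> null_sets \<mu>" for n
      using big0[of a "\<rho> a + 1 / Suc n"] big_sets by (auto simp: null_sets_def emeasure_eq_measure)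
    ultimately show ?thesis by auto
  qed
  have eq: "characters - gelfand_spectrum \<rho> = characters \<inter> (\<Union>a. U a)"
    unfolding gelfand_spectrum_eq[OF sub] U_def by (auto simp flip: not_le)
  have "characters - gelfand_spectrum \<rho> \<in> sets \<mu>"
    unfolding sets using closed_characters compact_imp_closed[OF compact_gelfand_spectrum[OF sub]]
    by (intro conjI Diff_subset sets.Diff borel_closed)
  from radon_measure_character_topologyD(3)[OF radon this]
  have "emeasure \<mu> (characters - gelfand_spectrum \<rho>) =
    (SUP C\<in>{C. compact C \<and> C \<subseteq> characters - gelfand_spectrum \<rho>}. emeasure \<mu> C)" .
  also have "\<dots> \<le> 0"
  proof (rule SUP_least)
    fix C assume "C \<in> {C. compact C \<and> C \<subseteq> characters - gelfand_spectrum \<rho>}"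
    then have C: "compact C" "C \<subseteq> characters \<inter> (\<Union>a. U a)" unfolding eq by blast+
    then obtain I where I: "finite I" "C \<subseteq> (\<Union>a\<in>I. U a)"
      using compactE_image[of C UNIV U] U_open by auto
    have null: "(\<Union>a\<in>I. characters \<inter> U a) \<in> null_sets \<mu>"
      using I(1) U_null by (intro null_sets_UN') (auto simp: countable_finite)
    have "emeasure \<mu> C \<le> emeasure \<mu> (\<Union>a\<in>I. characters \<inter> U a)"
      using C I null by (intro emeasure_mono) auto
    then show "emeasure \<mu> C \<le> 0" using null by (simp add: null_sets_def)
  qed
  finally show ?thesis by simp
qed

text \<open>An element \<open>b\<close> that is almost \<open>1\<close> on \<open>C\<close>, and almost \<open>0\<close> on a compact \<open>D\<close> that nearly exhausts
  \<open>G - C\<close> for \<open>\<nu>\<close>, has integral \<open>L b\<close> for both measures. This integral is at least about the \<open>\<mu>\<close>-measure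
  of \<open>C\<close> and at most about its \<open>\<nu>\<close>-measure.\<close>

lemma representing_measure_compact_le:
  fixes L :: "'a::{real_algebra, comm_ring, comm_monoid_mult} \<Rightarrow> real"
  assumes G: "compact G" "G \<subseteq> characters" and C: "compact C" "C \<subseteq> G"
    and \<mu>: "radon_measure character_topology \<mu>" "represents \<mu> L" "emeasure \<mu> (characters - G) = 0"
    and \<nu>: "radon_measure character_topology \<nu>" "represents \<nu> L" "emeasure \<nu> (characters - G) = 0"
  shows "emeasure \<mu> C \<le> emeasure \<nu> C"
proof -
  interpret \<mu>: finite_measure \<mu> by (rule finite_measure_representing[OF \<mu>(1,2)])
  interpret \<nu>: finite_measure \<nu> by (rule finite_measure_representing[OF \<nu>(1,2)])
  note sets\<mu> = radon_measure_character_topologyD(1)[OF \<mu>(1)] and space\<mu> = radon_measure_character_topologyD(2)[OF \<mu>(1)]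
  note sets\<nu> = radon_measure_character_topologyD(1)[OF \<nu>(1)] and space\<nu> = radon_measure_character_topologyD(2)[OF \<nu>(1)]
  have cb: "D \<in> sets borel" if "compact D" for D :: "('a \<Rightarrow> real) set"
    using compact_imp_closed[OF that] by (rule borel_closed)
  have ch: "(characters :: ('a \<Rightarrow> real) set) \<in> sets borel" by (rule borel_closed[OF closed_characters])
  have AE_G: "AE \<alpha> in \<mu>. \<alpha> \<in> G" "AE \<alpha> in \<nu>. \<alpha> \<in> G"
    using \<mu>(3) \<nu>(3) cb[OF G(1)] ch
    by (auto intro!: AE_I[of _ _ "characters - G"] simp: space\<mu> space\<nu> sets\<mu> sets\<nu>)
  have le: "(1 - e) * measure \<mu> C \<le> measure \<nu> C + e + e * measure \<nu> characters"
    if e: "0 < e" "e < 1" for e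
  proof -
    have GC: "G - C \<in> sets \<nu>" unfolding sets\<nu> using G C cb by auto
    have "\<exists>D. compact D \<and> D \<subseteq> G - C \<and> measure \<nu> (G - C) \<le> measure \<nu> D + e"
    proof (cases "measure \<nu> (G - C) < e")
      case True
      then show ?thesis by (intro exI[of _ "{}"]) auto
    next
      case False
      then have "ennreal (measure \<nu> (G - C) - e) < emeasure \<nu> (G - C)"
        using e by (simp add: \<nu>.emeasure_eq_measure ennreal_less_iff)
      then obtain D where "compact D" "D \<subseteq> G - C" "ennreal (measure \<nu> (G - C) - e) < emeasure \<nu> D"
        unfolding radon_measure_character_topologyD(3)[OF \<nu>(1) GC] less_SUP_iff by auto
      then show ?thesis using False
        by (intro exI[of _ D]) (auto simp: \<nu>.emeasure_eq_measure ennreal_less_iff)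
    qed
    then obtain D where D: "compact D" "D \<subseteq> G - C" "measure \<nu> (G - C) \<le> measure \<nu> D + e" by blast
    obtain b where b: "\<forall>\<alpha>\<in>G. 0 \<le> \<alpha> b \<and> \<alpha> b \<le> 1" "\<forall>\<alpha>\<in>D. \<alpha> b < e" "\<forall>\<alpha>\<in>C. 1 - e < \<alpha> b"
      using separating_element[OF G compact_imp_closed[OF D(1)] _ compact_imp_closed[OF C(1)] C(2) _ e] D(2) by auto
    have Cs: "C \<in> sets \<mu>" "C \<in> sets \<nu>" "D \<in> sets \<nu>"
      using C D G cb unfolding sets\<mu> sets\<nu> by auto
    have "(1 - e) * measure \<mu> C = (\<integral>\<alpha>. (1 - e) * indicator C \<alpha> \<partial>\<mu>)" using Cs by simp
    also have "\<dots> \<le> (\<integral>\<alpha>. \<alpha> b \<partial>\<mu>)"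
    proof (rule integral_mono_AE)
      show "integrable \<mu> (\<lambda>\<alpha>. (1 - e) * indicator C \<alpha>)"
        using Cs by (intro integrable_mult_right integrable_real_indicator) (auto simp: less_top[symmetric])
      show "integrable \<mu> (\<lambda>\<alpha>. \<alpha> b)" using \<mu>(2) by (simp add: represents_def)
      show "AE \<alpha> in \<mu>. (1 - e) * indicator C \<alpha> \<le> \<alpha> b"
        using AE_G(1) by eventually_elim (use b in \<open>auto simp: indicator_def less_imp_le\<close>)
    qed
    also have "\<dots> = (\<integral>\<alpha>. \<alpha> b \<partial>\<nu>)" using \<mu>(2) \<nu>(2) by (simp add: represents_def)
    also have "\<dots> \<le> (\<integral>\<alpha>. indicator (G - D) \<alpha> + e * indicator characters \<alpha> \<partial>\<nu>)"
    proof (rule integral_mono_AE)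
      show "integrable \<nu> (\<lambda>\<alpha>. \<alpha> b)" using \<nu>(2) by (simp add: represents_def)
      show "integrable \<nu> (\<lambda>\<alpha>. indicator (G - D) \<alpha> + e * indicator characters \<alpha>)"
        using G D cb ch
        by (intro Bochner_Integration.integrable_add integrable_mult_right integrable_real_indicator) (auto simp: sets\<nu> less_top[symmetric])
      show "AE \<alpha> in \<nu>. \<alpha> b \<le> indicator (G - D) \<alpha> + e * indicator characters \<alpha>"
        using AE_G(2)
      proof eventually_elim
        fix \<alpha> assume \<alpha>: "\<alpha> \<in> G"
        have "\<alpha> b \<le> 1" "\<alpha> \<in> D \<Longrightarrow> \<alpha> b \<le> e" "\<alpha> \<in> characters" using \<alpha> b G by (auto simp: less_imp_le)
        then show "\<alpha> b \<le> indicator (G - D) \<alpha> + e * indicator characters \<alpha>"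
          using \<alpha> e by (cases "\<alpha> \<in> D") auto
      qed
    qed
    also have "\<dots> = measure \<nu> (G - D) + e * measure \<nu> characters"
    proof -
      have "(G - D) \<inter> space \<nu> = G - D" "characters \<inter> space \<nu> = characters" using G by (auto simp: space\<nu>)
      then show ?thesis using G D cb ch by (subst Bochner_Integration.integral_add)
        (auto simp: sets\<nu> less_top[symmetric] intro!: integrable_mult_right integrable_real_indicator)
    qed
    also have "measure \<nu> (G - D) \<le> measure \<nu> C + e"
    proof -
      have Gs: "G \<in> sets \<nu>" using G cb by (simp add: sets\<nu>)
      have "measure \<nu> (G - D) = measure \<nu> G - measure \<nu> D" "measure \<nu> (G - C) = measure \<nu> G - measure \<nu> C"
        using Cs Gs D(2) C(2) by (auto intro!: \<nu>.finite_measure_Diff)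
      then show ?thesis using D(3) by linarith
    qed
    finally show ?thesis by simp
  qed
  have "measure \<mu> C \<le> measure \<nu> C"
  proof (rule tendsto_le[OF trivial_limit_at_right_real])
    show "((\<lambda>e. (1 - e) * measure \<mu> C) \<longlongrightarrow> measure \<mu> C) (at_right 0)"
      by (rule tendsto_eq_intros refl | simp)+
    show "((\<lambda>e. measure \<nu> C + e + e * measure \<nu> characters) \<longlongrightarrow> measure \<nu> C) (at_right 0)"
      by (rule tendsto_eq_intros refl | simp)+
    show "\<forall>\<^sub>F e in at_right 0. (1 - e) * measure \<mu> C \<le> measure \<nu> C + e + e * measure \<nu> characters"
      unfolding eventually_at_right_field using le by (intro exI[of _ 1]) auto
  qed
  then show ?thesis by (simp add: \<mu>.emeasure_eq_measure \<nu>.emeasure_eq_measure ennreal_leI)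
qed

text \<open>The two measures agree on compact subsets of \<open>G\<close> by symmetry, then on all compact sets because
  they are carried by \<open>G\<close>, and finally on all Borel sets by inner regularity.\<close>

lemma representing_measure_unique:
  fixes L :: "'a::{real_algebra, comm_ring, comm_monoid_mult} \<Rightarrow> real"
  assumes G: "compact G" "G \<subseteq> characters"
    and \<mu>: "radon_measure character_topology \<mu>" "represents \<mu> L" "emeasure \<mu> (characters - G) = 0"
    and \<nu>: "radon_measure character_topology \<nu>" "represents \<nu> L" "emeasure \<nu> (characters - G) = 0"
  shows "\<mu> = \<nu>"
proof (rule measure_eqI)
  have cb: "D \<in> sets borel" if "compact D" for D :: "('a \<Rightarrow> real) set"
    using compact_imp_closed[OF that] by (rule borel_closed)
  show sets: "sets \<mu> = sets \<nu>" using \<mu>(1) \<nu>(1) by (simp add: radon_measure_def)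
  have on_G: "emeasure \<mu>' C = emeasure \<mu>' (C \<inter> G)"
    if \<mu>': "radon_measure character_topology \<mu>'" "emeasure \<mu>' (characters - G) = 0"
      and C: "compact C" "C \<subseteq> characters" for \<mu>' C
  proof (rule emeasure_eq_AE)
    note sets' = radon_measure_character_topologyD(1)[OF \<mu>'(1)]
    show "C \<in> sets \<mu>'" "C \<inter> G \<in> sets \<mu>'" unfolding sets' using C G cb by auto
    show "AE \<alpha> in \<mu>'. \<alpha> \<in> C \<longleftrightarrow> \<alpha> \<in> C \<inter> G"
      using \<mu>'(2) cb[OF G(1)] borel_closed[OF closed_characters] C
      by (intro AE_I[of _ _ "characters - G"]) (auto simp: sets')
  qed
  have eq: "emeasure \<mu> C = emeasure \<nu> C" if C: "compact C" "C \<subseteq> characters" for C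
  proof -
    have "compact (C \<inter> G)" using C(1) G(1) by (rule compact_Int)
    then have "emeasure \<mu> (C \<inter> G) = emeasure \<nu> (C \<inter> G)"
      using representing_measure_compact_le[OF G _ _ \<mu> \<nu>] representing_measure_compact_le[OF G _ _ \<nu> \<mu>]
      by (intro antisym) auto
    then show ?thesis using on_G[OF \<mu>(1,3) C] on_G[OF \<nu>(1,3) C] by simp
  qed
  show "emeasure \<mu> B = emeasure \<nu> B" if B: "B \<in> sets \<mu>" for B
  proof -
    have "B \<subseteq> characters" using B radon_measure_character_topologyD(1)[OF \<mu>(1)] by blast
    then show ?thesis
      using radon_measure_character_topologyD(3)[OF \<mu>(1) B]
        radon_measure_character_topologyD(3)[OF \<nu>(1) B[unfolded sets]]
      by (auto intro!: SUP_cong eq)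
  qed
qed

theorem corollary3p8:
  fixes \<rho> L :: "'a::{real_algebra, comm_ring, comm_monoid_mult} \<Rightarrow> real"
    and S :: "'a set" and d :: nat
  assumes "submultiplicative_seminorm \<rho>"
    and "d \<ge> 1"
    and "power_module (2 * d) S"
    and "linear L" and "seminorm_continuous \<rho> L"
    and "\<forall>s\<in>S. 0 \<le> L s"
  shows "(\<exists>!\<mu>. radon_measure character_topology \<mu> \<and> represents \<mu> L) \<and>
    (\<forall>\<mu>. radon_measure character_topology \<mu> \<and> represents \<mu> L \<longrightarrow>
       measure_support character_topology \<mu> \<subseteq> nonneg_characters S \<inter> gelfand_spectrum \<rho>)"
proof -
  note sub = assms(1)
  have \<rho>: "seminorm \<rho>" using sub by (simp add: submultiplicative_seminorm_def)
  define K where "K = nonneg_characters S \<inter> gelfand_spectrum \<rho>"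
  have K: "compact K" "K \<subseteq> characters"
    using compact_Int_closed[OF compact_gelfand_spectrum[OF sub] closed_nonneg_characters[of S]]
    by (simp_all add: K_def Int_commute nonneg_characters_def subset_iff)
  obtain c where c: "\<And>a. \<bar>L a\<bar> \<le> c * \<rho> a"
    using assms(5) seminorm_continuous_iff_bounded[OF \<rho> assms(4)] by blast
  interpret positive_on_characters K L
  proof (rule positive_on_characters.intro)
    show "0 \<le> L a" if "\<And>\<alpha>. \<alpha> \<in> K \<Longrightarrow> 0 \<le> \<alpha> a" for a
      using nonneg_on_spectrum_imp_nonneg[OF sub _ assms(3,4) _ assms(6)] that assms(2) c
      unfolding K_def by (metis mult_2 trans_le_add1)
  qed (fact K assms)+
  obtain \<mu> where \<mu>: "radon_measure character_topology \<mu>" "represents \<mu> L" "emeasure \<mu> (characters - K) = 0"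
    using representing_radon_measure_exists by blast
  have G: "compact (gelfand_spectrum \<rho>)" "gelfand_spectrum \<rho> \<subseteq> characters"
    using compact_gelfand_spectrum[OF sub] by (auto simp: gelfand_spectrum_def)
  have unique: "\<nu> = \<mu>" if \<nu>: "radon_measure character_topology \<nu>" "represents \<nu> L" for \<nu>
    using representing_measure_unique[OF G \<nu> _ \<mu>(1,2)]
      representing_measure_concentrated[OF sub c \<nu>] representing_measure_concentrated[OF sub c \<mu>(1,2)]
    by blast
  have "measure_support character_topology \<mu> \<subseteq> K"
  proof
    fix \<alpha> assume "\<alpha> \<in> measure_support character_topology \<mu>"
    then have \<alpha>: "\<alpha> \<in> characters" "\<And>U. openin character_topology U \<Longrightarrow> \<alpha> \<in> U \<Longrightarrow> 0 < emeasure \<mu> U"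
      by (auto simp: measure_support_def)
    have "openin character_topology (characters - K)"
      unfolding openin_character_topology using compact_imp_closed[OF K(1)] by (intro exI[of _ "- K"]) auto
    with \<alpha> \<mu>(3) show "\<alpha> \<in> K" by force
  qed
  with \<mu> unique show ?thesis unfolding K_def by blast
qed

end
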